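(* Let $q$ be a prime power. For integers $0<\rho<n\le m$, $$K_R(q^m,n,\rho)\le q^{\max\{m-\rho,\,n\}(n-\rho)}.$$
   Context: For $\mathbf{x}\in \mathrm{GF}(q^m)^n$, $\mathrm{rk}(\mathbf{x})$ is the maximum number of coordinates of $\mathbf{x}$ that are linearly independent over $\mathrm{GF}(q)$; the rank distance is $d_R(\mathbf{x},\mathbf{y})=\mathrm{rk}(\mathbf{x}-\mathbf{y})$. The rank covering radius of a nonempty code $C\subseteq \mathrm{GF}(q^m)^n$ is $\max_{\mathbf{x}}\min_{\mathbf{c}\in C} d_R(\mathbf{x},\mathbf{c})$. $K_R(q^m,n,\rho)$ denotes the minimum number of balls of rank radius $\rho$ needed to cover $\mathrm{GF}(q^m)^n$, i.e. the minimum cardinality of a (not necessarily linear) code $C\subseteq\mathrm{GF}(q^m)^n$ with rank covering radius at most $\rho$. *)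

theory Defs
  imports "HOL-Algebra.Embedded_Algebras" "HOL-Number_Theory.Prime_Powers"
begin

text \<open>
  A pair \<open>L\<close>, \<open>K\<close> consisting of a field \<open>L\<close> with \<open>q ^ m\<close> elements and its subfield \<open>K\<close>
  with \<open>q\<close> elements represents \<open>GF(q^m)\<close> and \<open>GF(q)\<close>.  The vectors in \<open>GF(q^m)^n\<close> are
  the lists of length \<open>n\<close> over \<open>carrier L\<close>.
\<close>

definition vectors :: "('a, 'b) ring_scheme \<Rightarrow> nat \<Rightarrow> 'a list set" where
  "vectors L n = {x. length x = n \<and> set x \<subseteq> carrier L}"

definition vec_diff :: "('a, 'b) ring_scheme \<Rightarrow> 'a list \<Rightarrow> 'a list \<Rightarrow> 'a list" where
  "vec_diff L x y = map2 (\<lambda>a b. a \<ominus>\<^bsub>L\<^esub> b) x y"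

text \<open>
  \<open>nths x S\<close> lists the coordinates of \<open>x\<close> at the positions in \<open>S\<close>; equal coordinates at
  distinct positions are kept, and they make the list dependent.
\<close>

definition rk :: "('a, 'b) ring_scheme \<Rightarrow> 'a set \<Rightarrow> 'a list \<Rightarrow> nat" where
  "rk L K x = Max {card S |S. S \<subseteq> {..<length x} \<and> ring.independent L K (nths x S)}"

definition rank_dist :: "('a, 'b) ring_scheme \<Rightarrow> 'a set \<Rightarrow> 'a list \<Rightarrow> 'a list \<Rightarrow> nat" where
  "rank_dist L K x y = rk L K (vec_diff L x y)"

text \<open>The maxima and minima below are over finite nonempty sets when \<open>carrier L\<close> is finite.\<close>

definition covering_radius ::
    "('a, 'b) ring_scheme \<Rightarrow> 'a set \<Rightarrow> nat \<Rightarrow> 'a list set \<Rightarrow> nat" where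
  "covering_radius L K n C =
     Max ((\<lambda>x. Min ((\<lambda>c. rank_dist L K x c) ` C)) ` vectors L n)"

definition K_R :: "('a, 'b) ring_scheme \<Rightarrow> 'a set \<Rightarrow> nat \<Rightarrow> nat \<Rightarrow> nat" where
  "K_R L K n \<rho> =
     Min {card C |C. C \<subseteq> vectors L n \<and> C \<noteq> {} \<and> covering_radius L K n C \<le> \<rho>}"

end

theory Submission
  imports "HOL-Algebra.Algebraic_Closure" "HOL-Algebra.Multiplicative_Group" Defs
begin

text \<open>
  Put \<open>k = n - \<rho>\<close> and \<open>N = max (m - \<rho>) n\<close>, and let \<open>S\<close> be the field with \<open>q ^ N\<close> elements, the
  roots of \<open>X ^ (q ^ N) - X\<close> in an algebraic closure of \<open>L\<close>.  Choose \<open>K\<close>-independent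
  \<open>g\<^sub>0, \<dots>, g\<^sub>n\<^sub>-\<^sub>1\<close> in \<open>S\<close>, a subspace \<open>W\<close> of \<open>L\<close> of dimension \<open>m - \<rho>\<close> and a \<open>K\<close>-linear map \<open>\<psi>\<close> from
  \<open>S\<close> onto \<open>W\<close>.  The code consists of the \<open>\<psi>\<close>-images of the Gabidulin codewords: all
  \<open>(\<psi> (f g\<^sub>0), \<dots>, \<psi> (f g\<^sub>n\<^sub>-\<^sub>1))\<close> with \<open>f x = \<Sum>j<k. a\<^sub>j x ^ (q ^ j)\<close> and coefficients in \<open>S\<close>.

  Given \<open>x\<close>, modulo \<open>W\<close> all coordinates lie in the span of those at \<open>\<rho>\<close> suitable positions \<open>J\<close>,
  because \<open>L / W\<close> has dimension \<open>\<rho>\<close>: for each of the \<open>k\<close> other positions \<open>i\<close>,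
  \<open>x\<^sub>i = (\<Sum>j\<in>J. c\<^sub>i\<^sub>j x\<^sub>j) + t\<^sub>i\<close> with \<open>t\<^sub>i\<close> in \<open>W\<close>.  The elements \<open>b\<^sub>i = g\<^sub>i - (\<Sum>j\<in>J. c\<^sub>i\<^sub>j g\<^sub>j)\<close> are
  independent, so \<open>f\<close> can be interpolated with \<open>\<psi> (f b\<^sub>i) = t\<^sub>i\<close>.  Then the difference of \<open>x\<close> and
  the codeword of \<open>f\<close> satisfies \<open>y\<^sub>i = \<Sum>j\<in>J. c\<^sub>i\<^sub>j y\<^sub>j\<close>, hence has rank at most \<open>\<rho>\<close>.
\<close>

section \<open>The Frobenius map and finite fields\<close>

lemma (in cring) binomial_ring:
  fixes n :: nat
  assumes x: "x \<in> carrier R" and y: "y \<in> carrier R"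
  shows "(x \<oplus> y) [^] n = (\<Oplus>k \<in> {..n}. [(n choose k)] \<cdot> (x [^] k \<otimes> y [^] (n - k)))"
proof (induction n)
  case 0
  show ?case using x y by simp
next
  case (Suc n)
  let ?t = "\<lambda>k. x [^] k \<otimes> y [^] (Suc n - k)"
  have t: "?t k \<in> carrier R" for k using x y by simp
  have "[(n choose k)] \<cdot> (x [^] k \<otimes> y [^] (n - k)) \<otimes> x = [(n choose k)] \<cdot> ?t (Suc k)" for k
    using x y by (simp add: add_pow_ldistr add_pow_rdistr m_ac)
  then have mul_x: "(\<Oplus>k \<in> {..n}. [(n choose k)] \<cdot> (x [^] k \<otimes> y [^] (n - k))) \<otimes> x
      = (\<Oplus>k \<in> {..n}. [(n choose k)] \<cdot> ?t (Suc k))"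
    using x y by (subst finsum_ldistr) (auto intro!: finsum_cong')
  have "[(n choose k)] \<cdot> (x [^] k \<otimes> y [^] (n - k)) \<otimes> y = [(n choose k)] \<cdot> ?t k" if "k \<le> n" for k
    using x y that by (simp add: add_pow_ldistr m_assoc Suc_diff_le)
  then have "(\<Oplus>k \<in> {..n}. [(n choose k)] \<cdot> (x [^] k \<otimes> y [^] (n - k))) \<otimes> y
      = (\<Oplus>k \<in> {..n}. [(n choose k)] \<cdot> ?t k)"
    using x y by (subst finsum_ldistr) (auto intro!: finsum_cong')
  \<comment> \<open>The added term at \<open>Suc n\<close> has coefficient zero. With it, splitting
    off index 0 leaves a sum with the same indices as the one obtained from \<open>x\<close>, ready
    for Pascal's rule.\<close>
  also have "\<dots> = (\<Oplus>k \<in> {..Suc n}. [(n choose k)] \<cdot> ?t k)"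
    using t x y by (subst finsum_Suc) (auto simp: binomial_eq_0)
  also have "\<dots> = (\<Oplus>k \<in> {..n}. [(n choose Suc k)] \<cdot> ?t (Suc k)) \<oplus> ?t 0"
    using t x y by (subst finsum_Suc2) auto
  finally have mul_y: "(\<Oplus>k \<in> {..n}. [(n choose k)] \<cdot> (x [^] k \<otimes> y [^] (n - k))) \<otimes> y
      = (\<Oplus>k \<in> {..n}. [(n choose Suc k)] \<cdot> ?t (Suc k)) \<oplus> ?t 0" .
  have "(x \<oplus> y) [^] Suc n =
      (\<Oplus>k \<in> {..n}. [(n choose k)] \<cdot> ?t (Suc k)) \<oplus>
      ((\<Oplus>k \<in> {..n}. [(n choose Suc k)] \<cdot> ?t (Suc k)) \<oplus> ?t 0)"
    using x y by (simp only: nat_pow_Suc Suc.IH) (subst r_distr, auto simp: mul_x mul_y)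
  also have "\<dots> = ((\<Oplus>k \<in> {..n}. [(n choose k)] \<cdot> ?t (Suc k)) \<oplus>
      (\<Oplus>k \<in> {..n}. [(n choose Suc k)] \<cdot> ?t (Suc k))) \<oplus> ?t 0"
    by (rule a_assoc[symmetric]; (rule finsum_closed)?) (simp_all add: x y)
  also have "(\<Oplus>k \<in> {..n}. [(n choose k)] \<cdot> ?t (Suc k)) \<oplus>
      (\<Oplus>k \<in> {..n}. [(n choose Suc k)] \<cdot> ?t (Suc k))
      = (\<Oplus>k \<in> {..n}. [(n choose k)] \<cdot> ?t (Suc k) \<oplus> [(n choose Suc k)] \<cdot> ?t (Suc k))"
    by (rule finsum_addf[symmetric]) (simp_all add: x y)
  also have "\<dots> = (\<Oplus>k \<in> {..n}. [(Suc n choose Suc k)] \<cdot> ?t (Suc k))"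
  proof (rule finsum_cong')
    show "[(n choose k)] \<cdot> ?t (Suc k) \<oplus> [(n choose Suc k)] \<cdot> ?t (Suc k)
        = [(Suc n choose Suc k)] \<cdot> ?t (Suc k)" for k
      unfolding binomial_Suc_Suc by (rule add.nat_pow_mult[OF t])
  qed (simp_all add: x y)
  also have "\<dots> \<oplus> ?t 0 = (\<Oplus>k \<in> {..Suc n}. [(Suc n choose k)] \<cdot> ?t k)"
  proof -
    have "(\<lambda>k. [(Suc n choose k)] \<cdot> ?t k) \<in> {..Suc n} \<rightarrow> carrier R" using t by auto
    from finsum_Suc2[OF this] show ?thesis using x y by simp
  qed
  finally show ?case .
qed

lemma (in ring) add_pow_eq_zero:
  fixes p n :: nat
  assumes "[p] \<cdot> \<one> = \<zero>" "p dvd n" "x \<in> carrier R"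
  shows "[n] \<cdot> x = \<zero>"
proof -
  have "[p] \<cdot> x = \<zero>"
    using add_pow_ldistr[of \<one> x p] assms by simp
  moreover obtain l where "n = p * l" using assms(2) by blast
  ultimately show ?thesis using assms(3) by (simp flip: add.nat_pow_pow)
qed

lemma (in cring) freshman_dream_prime:
  fixes p :: nat
  assumes p: "prime p" "[p] \<cdot> \<one> = \<zero>" and x: "x \<in> carrier R" and y: "y \<in> carrier R"
  shows "(x \<oplus> y) [^] p = x [^] p \<oplus> y [^] p"
proof -
  \<comment> \<open>This form of \<open>p\<close> lets both extreme terms be split off; every
    coefficient strictly between them is divisible by \<open>p\<close>.\<close>
  obtain n where n: "p = Suc (Suc n)"
    using le_Suc_ex[OF prime_ge_2_nat[OF p(1)]] by auto
  let ?t = "\<lambda>k. [(p choose k)] \<cdot> (x [^] k \<otimes> y [^] (p - k))"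
  have t: "?t \<in> A \<rightarrow> carrier R" for A using x y by auto
  have inner: "?t k = \<zero>" if "k \<in> {1..Suc n}" for k
    by (rule add_pow_eq_zero[OF p(2)])
       (use that n x y p(1) dvd_choose_prime[of k p] in auto)
  have zero: "?t (Suc k) = \<zero>" if "k \<le> n" for k
    by (rule inner) (use that in auto)
  have "(x \<oplus> y) [^] p = (\<Oplus>k \<in> {..Suc (Suc n)}. ?t k)"
    using binomial_ring[OF x y, of p] n by simp
  also have "\<dots> = ?t p \<oplus> ((\<Oplus>k \<in> {..n}. ?t (Suc k)) \<oplus> ?t 0)"
    unfolding n by (subst finsum_Suc; (subst finsum_Suc2)?) (use x y in simp_all)
  also have "(\<Oplus>k \<in> {..n}. ?t (Suc k)) = (\<Oplus>k \<in> {..n}. \<zero>)"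
    by (rule finsum_cong') (simp_all only: zero zero_closed Pi_I mem_Collect_eq atMost_iff)
  also have "\<dots> = \<zero>" by simp
  finally show ?thesis using x y by simp
qed

lemma (in cring) freshman_dream:
  fixes p r :: nat
  assumes "prime p" "[p] \<cdot> \<one> = \<zero>" "x \<in> carrier R" "y \<in> carrier R"
  shows "(x \<oplus> y) [^] (p ^ r) = x [^] (p ^ r) \<oplus> y [^] (p ^ r)"
proof (induction r)
  case 0
  then show ?case using assms by simp
next
  case (Suc r)
  have "(x \<oplus> y) [^] (p ^ Suc r) = ((x \<oplus> y) [^] (p ^ r)) [^] p"
    using assms by (simp add: nat_pow_pow mult.commute)
  also have "\<dots> = (x [^] (p ^ r)) [^] p \<oplus> (y [^] (p ^ r)) [^] p"
    using assms by (simp add: Suc freshman_dream_prime)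
  finally show ?case
    using assms by (simp add: nat_pow_pow mult.commute)
qed

text \<open>In a domain the multiple of one by \<open>p ^ r\<close> is the \<open>r\<close>-th power
  of its multiple by \<open>p\<close>, so the latter must vanish. This passes from the order
  \<open>q\<close> of a finite subfield to the prime that the freshman's dream needs.\<close>

lemma (in domain) char_prime:
  fixes p r :: nat
  assumes "[(p ^ r)] \<cdot> \<one> = \<zero>"
  shows "[p] \<cdot> \<one> = \<zero>"
proof -
  have "[(p ^ r)] \<cdot> \<one> = ([p] \<cdot> \<one>) [^] r"
  proof (induction r)
    case (Suc r)
    have "[(p ^ Suc r)] \<cdot> \<one> = [p] \<cdot> ([(p ^ r)] \<cdot> \<one>)"
      by (simp add: add.nat_pow_pow mult.commute)
    also have "\<dots> = ([(p ^ r)] \<cdot> \<one>) \<otimes> ([p] \<cdot> \<one>)"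
      by (simp add: add_pow_rdistr)
    finally show ?case using Suc by simp
  qed simp
  moreover have "([p] \<cdot> \<one>) [^] r \<noteq> \<zero>" if "[p] \<cdot> \<one> \<noteq> \<zero>"
    using that by (induction r) (auto simp: integral_iff)
  ultimately show ?thesis using assms by auto
qed

text \<open>Lagrange's theorem in the additive group of \<open>K\<close>, whose multiples agree with
  those taken in the whole ring.\<close>

lemma (in ring) card_subfield_add_pow:
  assumes "subfield K R" "finite K"
  shows "[(card K)] \<cdot> \<one> = \<zero>"
proof -
  interpret K: field "R \<lparr> carrier := K \<rparr>" using subfield_iff(2) assms by blast
  have eq: "[n] \<cdot>\<^bsub>R \<lparr> carrier := K \<rparr>\<^esub> x = [n] \<cdot> x" for n :: nat and x
    by (induction n) (simp_all add: add_pow_def nat_pow_def)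
  have "\<one> [^]\<^bsub>add_monoid (R \<lparr> carrier := K \<rparr>)\<^esub> order (add_monoid (R \<lparr> carrier := K \<rparr>))
      = \<one>\<^bsub>add_monoid (R \<lparr> carrier := K \<rparr>)\<^esub>"
    by (rule group.pow_order_eq_1[OF K.add.is_group]) (use K.one_closed in simp)
  then show ?thesis by (simp add: order_def add_pow_def nat_pow_def)
qed

text \<open>Lagrange's theorem in the multiplicative group of \<open>K\<close>; zero is treated
  apart.\<close>

lemma (in ring) subfield_pow_card:
  assumes "subfield K R" "finite K" "x \<in> K"
  shows "x [^] card K = x"
proof -
  interpret K: field "R \<lparr> carrier := K \<rparr>" using subfield_iff(2) assms by blast
  have pos: "card K > 0" using assms card_gt_0_iff by blast
  have x: "x \<in> carrier R" using subfieldE(3) assms by blast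
  show ?thesis
  proof (cases "x = \<zero>")
    case True
    then show ?thesis using pos by (simp add: nat_pow_zero)
  next
    case False
    have "x [^]\<^bsub>Multiplicative_Group.mult_of (R \<lparr> carrier := K \<rparr>)\<^esub> order (Multiplicative_Group.mult_of (R \<lparr> carrier := K \<rparr>)) = \<one>"
      using group.pow_order_eq_1[OF K.field_mult_group, of x] False assms by simp
    then have "x [^] (card K - 1) = \<one>"
      using assms by (simp add: K.order_mult_of order_def nat_pow_def)
    then have "x [^] Suc (card K - 1) = x" using x by simp
    then show ?thesis using pos by simp
  qed
qed

section \<open>Counting roots and fixed points of Frobenius powers\<close>

lemma (in field) card_roots_le_degree:
  assumes "p \<in> carrier (poly_ring R)" "p \<noteq> []"
  shows "finite {x \<in> carrier R. eval p x = \<zero>}"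
    and "card {x \<in> carrier R. eval p x = \<zero>} \<le> degree p"
proof -
  have eq: "{x \<in> carrier R. eval p x = \<zero>} = set_mset (roots p)"
    using roots_mem_iff_is_root[OF assms(1)] assms(2) by (auto simp: is_root_def)
  show "finite {x \<in> carrier R. eval p x = \<zero>}" unfolding eq by simp
  show "card {x \<in> carrier R. eval p x = \<zero>} \<le> degree p"
    unfolding eq using size_roots_le_degree[OF assms(1)]
    by (metis order_trans mset_set_set_mset_msubset size_mset_mono size_mset_set)
qed

text \<open>The fixed points are the roots of X^Q - X with Q = \<open>p ^ r\<close>. This polynomial
  splits, so its roots counted with multiplicity number Q, and it remains to see that they are
  simple.\<close>

lemma (in field) card_frobenius_fixed:
  fixes p r :: nat
  assumes closed: "\<And>P. P \<in> carrier (poly_ring R) \<Longrightarrow> splitted P"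
    and p: "prime p" "[p] \<cdot> \<one> = \<zero>" and r: "0 < r"
  shows "card {x \<in> carrier R. x [^] (p ^ r) = x} = p ^ r"
proof -
  interpret UP: domain "poly_ring R"
    using univ_poly_is_domain[OF carrier_is_subring] .
  define Q where "Q = p ^ r"
  \<comment> \<open>Q is at least 2: X^Q then dominates X in the degree, and a positive power of X -
    a survives when one factor is cancelled below.\<close>
  obtain n where n: "Q = Suc (Suc n)"
    using le_Suc_ex[of 2 Q] prime_ge_2_nat[OF p(1)] self_le_power[of p r] r
    unfolding Q_def by auto
  note X = var_closed[OF carrier_is_subring]
  define P where "P = X [^]\<^bsub>poly_ring R\<^esub> Q \<ominus>\<^bsub>poly_ring R\<^esub> X"
  have P: "P \<in> carrier (poly_ring R)"
    unfolding P_def using X by simp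
  have eval_P: "eval P a = a [^] Q \<ominus> a" if a: "a \<in> carrier R" for a
  proof -
    interpret ev: ring_hom_ring "poly_ring R" R "\<lambda>p. eval p a"
      using eval_ring_hom[OF carrier_is_subring a] .
    show ?thesis
      unfolding P_def using X eval_var[OF a] by (simp add: a_minus_def ev.hom_nat_pow)
  qed
  have deg_P: "degree P = Q"
  proof -
    have "degree (\<ominus>\<^bsub>poly_ring R\<^esub> X) = 1"
      using univ_poly_a_inv_degree[OF carrier_is_subring X(1)] by (simp add: var_def)
    moreover have "degree (X [^]\<^bsub>poly_ring R\<^esub> Q) = Q"
      using unitary_monom_eq_var_pow[OF carrier_is_subring, of Q]
      by (metis diff_Suc_1 length_Cons length_replicate monom_def)
    ultimately show ?thesis
      using poly_add_degree_eq[OF carrier_is_subring, of "X [^]\<^bsub>poly_ring R\<^esub> Q" "\<ominus>\<^bsub>poly_ring R\<^esub> X"]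
        X n UP.a_inv_closed UP.nat_pow_closed
      unfolding P_def a_minus_def by (simp add: univ_poly_add univ_poly_carrier)
  qed
  have P_nonzero: "P \<noteq> []" using deg_P n by auto
  \<comment> \<open>A root \<open>a\<close> is simple since \<open>P = (X - a) ^ Q - (X - a)\<close> by the freshman's dream.\<close>
  have count: "count (roots P) a \<le> 1" for a
  proof (rule ccontr)
    assume "\<not> count (roots P) a \<le> 1"
    then have two: "2 \<le> alg_mult P a"
      using alg_mult_eq_count_roots[OF P] by simp
    then have root: "is_root P a"
      using alg_mult_gt_zero_iff_is_root[OF P, of a] by simp
    then have a: "a \<in> carrier R" and fix_a: "a [^] Q = a"
      using eval_P by (auto simp: is_root_def)
    interpret ev: ring_hom_ring "poly_ring R" R "\<lambda>p. eval p a"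
      using eval_ring_hom[OF carrier_is_subring a] .
    interpret const: ring_hom_ring R "poly_ring R" poly_of_const
      using canonical_embedding_ring_hom[OF carrier_is_subring] by simp
    have const_add_pow: "poly_of_const ([k] \<cdot> x) = [k] \<cdot>\<^bsub>poly_ring R\<^esub> poly_of_const x"
      if "x \<in> carrier R" for k :: nat and x
      using that by (induction k) simp_all
    \<comment> \<open>The freshman's dream is applied to polynomials, so the characteristic is
      carried over along the constants.\<close>
    have char_UP: "[p] \<cdot>\<^bsub>poly_ring R\<^esub> \<one>\<^bsub>poly_ring R\<^esub> = \<zero>\<^bsub>poly_ring R\<^esub>"
      using const_add_pow[OF one_closed, of p] p(2) by simp
    define c where "c = poly_of_const a"
    define A where "A = [\<one>, \<ominus> a]"
    have c: "c \<in> carrier (poly_ring R)" unfolding c_def using a by simp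
    have c_pow: "c [^]\<^bsub>poly_ring R\<^esub> Q = c"
      using const.hom_nat_pow[of a Q] a fix_a by (simp add: c_def)
    have A: "A \<in> carrier (poly_ring R)"
      unfolding A_def using a by (simp add: univ_poly_def polynomial_def)
    have X_eq: "X = A \<oplus>\<^bsub>poly_ring R\<^esub> c"
      unfolding A_def c_def var_def poly_of_const_def using a
      by (cases "a = \<zero>") (auto simp: univ_poly_add l_neg)
    have "X [^]\<^bsub>poly_ring R\<^esub> Q = A [^]\<^bsub>poly_ring R\<^esub> Q \<oplus>\<^bsub>poly_ring R\<^esub> c"
      using UP.freshman_dream[OF p(1) char_UP A c, of r] c_pow by (simp add: X_eq Q_def)
    then have "P = (A [^]\<^bsub>poly_ring R\<^esub> Q \<oplus>\<^bsub>poly_ring R\<^esub> c)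
        \<ominus>\<^bsub>poly_ring R\<^esub> (A \<oplus>\<^bsub>poly_ring R\<^esub> c)"
      unfolding P_def X_eq by simp
    also have "\<dots> = A [^]\<^bsub>poly_ring R\<^esub> Q \<ominus>\<^bsub>poly_ring R\<^esub> A"
      using A c UP.nat_pow_closed[OF A, of Q] by algebra
    also have "\<dots> = A \<otimes>\<^bsub>poly_ring R\<^esub>
        (A [^]\<^bsub>poly_ring R\<^esub> Suc n \<ominus>\<^bsub>poly_ring R\<^esub> \<one>\<^bsub>poly_ring R\<^esub>)"
      using A n UP.m_comm[OF A UP.nat_pow_closed[OF A, of "Suc n"]]
      by (simp add: UP.r_distr UP.r_minus a_minus_def)
    finally have P_A: "P = A \<otimes>\<^bsub>poly_ring R\<^esub>
        (A [^]\<^bsub>poly_ring R\<^esub> Suc n \<ominus>\<^bsub>poly_ring R\<^esub> \<one>\<^bsub>poly_ring R\<^esub>)" .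
    \<comment> \<open>A double root makes \<open>A\<close> squared divide \<open>P\<close>.
      Cancelling one factor \<open>A\<close> gives A^(Q-1) - 1 = A g, and evaluating at
      \<open>a\<close> yields -1 = 0.\<close>
    have "(A [^]\<^bsub>poly_ring R\<^esub> (2::nat)) pdivides P"
      unfolding A_def by (rule le_alg_mult_imp_pdivides[OF a P two])
    then obtain g where g: "g \<in> carrier (poly_ring R)"
      "P = A [^]\<^bsub>poly_ring R\<^esub> (2::nat) \<otimes>\<^bsub>poly_ring R\<^esub> g"
      unfolding pdivides_def factor_def by blast
    then have "P = A \<otimes>\<^bsub>poly_ring R\<^esub> (A \<otimes>\<^bsub>poly_ring R\<^esub> g)"
      using A by (simp add: numeral_2_eq_2 UP.m_assoc)
    moreover have "A \<noteq> \<zero>\<^bsub>poly_ring R\<^esub>" by (simp add: A_def univ_poly_zero)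
    ultimately have eq: "A [^]\<^bsub>poly_ring R\<^esub> Suc n \<ominus>\<^bsub>poly_ring R\<^esub> \<one>\<^bsub>poly_ring R\<^esub>
        = A \<otimes>\<^bsub>poly_ring R\<^esub> g"
      using P_A UP.m_lcancel[of A "A [^]\<^bsub>poly_ring R\<^esub> Suc n \<ominus>\<^bsub>poly_ring R\<^esub> \<one>\<^bsub>poly_ring R\<^esub>"
          "A \<otimes>\<^bsub>poly_ring R\<^esub> g"] A g(1) by simp
    have eval_A: "eval A a = \<zero>" unfolding A_def using a by (simp add: r_neg)
    have "eval (A [^]\<^bsub>poly_ring R\<^esub> Suc n \<ominus>\<^bsub>poly_ring R\<^esub> \<one>\<^bsub>poly_ring R\<^esub>) a = \<zero>"
      unfolding eq using A g(1) eval_A by simp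
    then have "\<ominus> \<one> = \<zero>"
      using A eval_A by (simp add: a_minus_def)
    then show False by (metis add.inv_eq_1_iff one_closed one_not_zero)
  qed
  have fixed_eq: "{x \<in> carrier R. x [^] Q = x} = set_mset (roots P)"
    using roots_mem_iff_is_root[OF P] P_nonzero eval_P by (auto simp: is_root_def)
  have "card (set_mset (roots P)) = (\<Sum>x \<in> set_mset (roots P). count (roots P) x)"
  proof -
    have "count (roots P) x = 1" if "x \<in># roots P" for x
      using that count[of x] by (metis One_nat_def Suc_leI count_greater_zero_iff le_antisym)
    then show ?thesis by simp
  qed
  also have "\<dots> = Q"
    using closed[OF P] deg_P by (simp add: splitted_def size_multiset_overloaded_eq)
  finally show ?thesis using fixed_eq by (simp add: Q_def)
qed

section \<open>Spans and independence over finite fields\<close>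

declare (in ring) Span.simps [simp del]

lemma (in ring) subfield_card_gt_1:
  assumes "subfield K R" "finite K"
  shows "1 < card K"
proof -
  interpret K: field "R \<lparr> carrier := K \<rparr>" using subfield_iff(2) assms by blast
  have "{\<zero>, \<one>} \<subseteq> K" "\<zero> \<noteq> \<one>"
    using K.zero_closed K.one_closed K.one_not_zero by auto
  then show ?thesis
    using card_mono[OF assms(2), of "{\<zero>, \<one>}"] by simp
qed

lemma (in ring) card_Span_le:
  assumes "subfield K R" "finite K" "set Us \<subseteq> carrier R"
  shows "finite (Span K Us)" "card (Span K Us) \<le> card K ^ length Us"
proof -
  let ?A = "{Ks. set Ks \<subseteq> K \<and> length Ks = length Us}"
  have eq: "Span K Us = (\<lambda>Ks. combine Ks Us) ` ?A"
    using Span_eq_combine_set_length_version[OF assms(1,3)] by auto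
  have fin: "finite ?A" by (rule finite_lists_length_eq[OF assms(2)])
  then show "finite (Span K Us)" unfolding eq by (rule finite_imageI)
  show "card (Span K Us) \<le> card K ^ length Us"
    unfolding eq using card_image_le[OF fin] card_lists_length_eq[OF assms(2)] by metis
qed

text \<open>Uniqueness of coordinates makes \<open>combine\<close> injective on coefficient
  lists.\<close>

lemma (in ring) card_Span_independent:
  assumes "subfield K R" "finite K" "independent K Us"
  shows "card (Span K Us) = card K ^ length Us"
proof -
  let ?A = "{Ks. set Ks \<subseteq> K \<and> length Ks = length Us}"
  note carr = independent_in_carrier[OF assms(3)]
  have eq: "Span K Us = (\<lambda>Ks. combine Ks Us) ` ?A"
    using Span_eq_combine_set_length_version[OF assms(1) carr] by auto
  have "inj_on (\<lambda>Ks. combine Ks Us) ?A"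
  proof (rule inj_onI)
    fix Ks Ks' assume *: "Ks \<in> ?A" "Ks' \<in> ?A" "combine Ks Us = combine Ks' Us"
    then have "combine Ks Us \<in> Span K Us" unfolding eq by blast
    from unique_decomposition[OF assms(1,3) this] show "Ks = Ks'"
      using * by (metis (mono_tags, lifting) mem_Collect_eq)
  qed
  then show ?thesis
    unfolding eq by (simp add: card_image card_lists_length_eq[OF assms(2)])
qed

text \<open>Over a finite field, comparing the cardinalities of the two spans replaces the exchange
  argument.\<close>

lemma (in ring) independent_length_le_spanning:
  assumes "subfield K R" "finite K" "independent K Us" "set Vs \<subseteq> carrier R" "set Us \<subseteq> Span K Vs"
  shows "length Us \<le> length Vs"
proof -
  have "card K ^ length Us \<le> card (Span K Vs)"
    unfolding card_Span_independent[OF assms(1-3), symmetric]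
    by (intro card_mono card_Span_le mono_Span_subset assms)
  also have "\<dots> \<le> card K ^ length Vs"
    by (intro card_Span_le assms)
  finally show ?thesis
    using subfield_card_gt_1[OF assms(1,2)] by simp
qed

text \<open>A list of all elements of \<open>V\<close> spans \<open>V\<close>, and a base can be
  filtered from it.\<close>

lemma (in ring) finite_subalgebra_base:
  assumes K: "subfield K R" and V: "subalgebra K V R" "finite V"
  obtains Us where "independent K Us" "Span K Us = V"
proof -
  obtain vs where vs: "set vs = V" using finite_list[OF V(2)] by blast
  have carr: "set vs \<subseteq> carrier R" using subalgebra_in_carrier[OF V(1)] vs by simp
  have "Span K vs = V"
    using subalgebra_Span_incl[OF K V(1), of vs] Span_base_incl[OF K carr] vs by blast
  then show thesis using filter_base[OF K carr] that by metis
qed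

text \<open>If a shifted entry x - u lay in the span of the later entries, adding back u, which lies
  in the span of \<open>ys\<close>, would put x there too. This yields the independence of the
  interpolation points \<open>b\<^sub>i\<close>.\<close>

lemma (in ring) independent_shift:
  assumes K: "subfield K R"
  shows "independent K (xs @ ys) \<Longrightarrow> length us = length xs \<Longrightarrow> set us \<subseteq> Span K ys
    \<Longrightarrow> independent K (map2 (\<lambda>a b. a \<ominus> b) xs us @ ys)"
proof (induction xs arbitrary: us)
  case Nil
  then show ?case by simp
next
  case (Cons x xs)
  then obtain u us' where us: "us = u # us'" by (metis length_Suc_conv)
  have indep: "independent K (xs @ ys)" and x: "x \<in> carrier R" "x \<notin> Span K (xs @ ys)"
    using independent_backwards[of K x "xs @ ys"] Cons.prems(1) by simp_all
  have carr: "set xs \<subseteq> carrier R" "set ys \<subseteq> carrier R"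
    using independent_in_carrier[OF indep] by auto
  have u: "u \<in> Span K ys" "set us' \<subseteq> Span K ys" using Cons.prems us by auto
  have ys_le: "Span K ys \<subseteq> Span K (xs @ ys)"
    using mono_Span_append(2)[OF K carr(2,1)] .
  have xs_le: "set xs \<subseteq> Span K (xs @ ys)"
    using Span_base_incl[OF K, of "xs @ ys"] carr by simp
  have sp: "a \<ominus> b \<in> Span K (xs @ ys)" if "a \<in> Span K (xs @ ys)" "b \<in> Span K (xs @ ys)" for a b
    using that Span_subgroup_props(3,4)[OF K, of "xs @ ys"] carr by (simp add: a_minus_def)
  have u_carr: "u \<in> carrier R" using u(1) Span_in_carrier[of K ys] subring_props(1)[OF K] carr by blast
  have "a \<ominus> b \<in> Span K (xs @ ys)" if "(a, b) \<in> set (zip xs us')" for a b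
    by (rule sp) (use that xs_le ys_le u(2) set_zip_leftD[OF that] set_zip_rightD[OF that] in auto)
  then have "set (map2 (\<lambda>a b. a \<ominus> b) xs us' @ ys) \<subseteq> Span K (xs @ ys)"
    using ys_le Span_base_incl[OF K carr(2)] by auto
  then have "Span K (map2 (\<lambda>a b. a \<ominus> b) xs us' @ ys) \<subseteq> Span K (xs @ ys)"
    using mono_Span_subset[OF K] carr by simp
  moreover have "x \<ominus> u \<notin> Span K (xs @ ys)"
  proof
    assume "x \<ominus> u \<in> Span K (xs @ ys)"
    then have "(x \<ominus> u) \<oplus> u \<in> Span K (xs @ ys)"
      using Span_subgroup_props(3)[OF K, of "xs @ ys"] u ys_le carr by auto
    moreover have "(x \<ominus> u) \<oplus> u = x" using x u_carr by (simp add: a_minus_def a_assoc l_neg)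
    ultimately show False using x by simp
  qed
  moreover have "independent K (map2 (\<lambda>a b. a \<ominus> b) xs us' @ ys)"
    using Cons.IH[OF indep _ u(2)] Cons.prems us by simp
  ultimately have "independent K ((x \<ominus> u) # map2 (\<lambda>a b. a \<ominus> b) xs us' @ ys)"
    using x(1) u_carr by (intro li_Cons) auto
  then show ?case by (simp add: us)
qed

text \<open>A longest list of positions whose coordinates stay independent together with
  \<open>Ws\<close> has at most \<open>\<rho>\<close> members, because \<open>Ws\<close> already
  takes up \<open>m - \<rho>\<close> dimensions. By maximality, every other coordinate lies in the
  span.\<close>

lemma (in ring) exists_spanning_coordinates:
  assumes K: "subfield K R" and dim: "dimension m K (carrier R)"
    and Ws: "independent K Ws" "length Ws = m - \<rho>" and \<rho>: "\<rho> \<le> m" "\<rho> \<le> length x"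
    and x: "set x \<subseteq> carrier R"
  obtains Ss Ts where "distinct (Ss @ Ts)" "set (Ss @ Ts) = {..<length x}" "length Ss = \<rho>"
    "\<And>i. i < length x \<Longrightarrow> x ! i \<in> Span K (map ((!) x) Ss @ Ws)"
proof -
  define P where "P Ss \<longleftrightarrow> distinct Ss \<and> set Ss \<subseteq> {..<length x} \<and> independent K (map ((!) x) Ss @ Ws)" for Ss
  have "P []" using Ws by (simp add: P_def)
  moreover have "\<forall>Ss. P Ss \<longrightarrow> length Ss < Suc (length x)"
    \<comment> \<open>Distinct positions bound the length of \<open>Ss\<close>, so a longest such
      list exists.\<close>
    using subset_eq_atLeast0_lessThan_card by (auto simp: P_def atLeast0LessThan less_Suc_eq_le distinct_card[symmetric])
  ultimately have "\<exists>Ss. P Ss \<and> (\<forall>Ss'. P Ss' \<longrightarrow> length Ss' \<le> length Ss)"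
    by (rule ex_has_greatest_nat)
  then obtain Ss where Ss: "P Ss" and max: "\<And>Ss'. P Ss' \<Longrightarrow> length Ss' \<le> length Ss"
    by (elim exE conjE) simp
  have carr: "set (map ((!) x) Ss @ Ws) \<subseteq> carrier R"
    using Ss independent_in_carrier unfolding P_def by blast
  have "length (map ((!) x) Ss @ Ws) \<le> m"
    by (rule independent_length_le_dimension[OF K dim]) (use Ss carr in \<open>auto simp: P_def\<close>)
  then have len: "length Ss \<le> \<rho>" using Ws \<rho> by simp
  have span: "x ! i \<in> Span K (map ((!) x) Ss @ Ws)" if i: "i < length x" for i
  proof (cases "i \<in> set Ss")
    case True
    then show ?thesis using Span_base_incl[OF K carr] by auto
  next
    case False
    then have "\<not> P (i # Ss)" using max[of "i # Ss"] by auto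
    then have "\<not> independent K (x ! i # map ((!) x) Ss @ Ws)"
      using False Ss i by (auto simp: P_def)
    moreover have "x ! i \<in> carrier R" using x nth_mem[OF i] by blast
    ultimately show ?thesis using Ss li_Cons unfolding P_def by blast
  qed
  \<comment> \<open>The longest list may have fewer than \<open>\<rho>\<close> positions. It is
    padded with arbitrary remaining ones, which only enlarges the span.\<close>
  obtain Rs where Rs: "set Rs = {..<length x} - set Ss" "distinct Rs"
    using finite_distinct_list[of "{..<length x} - set Ss"] by auto
  have "length (Ss @ Rs) = length x"
    using distinct_card[of "Ss @ Rs"] Rs Ss by (auto simp: P_def Un_absorb1)
  define Ss' where "Ss' = take \<rho> (Ss @ Rs)"
  define Ts where "Ts = drop \<rho> (Ss @ Rs)"
  have app: "Ss' @ Ts = Ss @ Rs" unfolding Ss'_def Ts_def by (rule append_take_drop_id)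
  have sub: "set Ss \<subseteq> set Ss'" using len by (auto simp: Ss'_def)
  have idx: "set Ss' \<subseteq> {..<length x}"
  proof -
    have "set Ss' \<subseteq> set (Ss @ Rs)" by (simp only: app[symmetric] set_append Un_upper1)
    then show ?thesis using Rs Ss by (auto simp: P_def)
  qed
  have carr': "set (map ((!) x) Ss' @ Ws) \<subseteq> carrier R"
    using idx x carr by (auto simp: subset_iff)
  show thesis
  proof (rule that[of Ss' Ts])
    show "distinct (Ss' @ Ts)" unfolding app using Rs Ss by (auto simp: P_def)
    show "set (Ss' @ Ts) = {..<length x}" unfolding app using Rs Ss by (auto simp: P_def)
    show "length Ss' = \<rho>" using \<open>length (Ss @ Rs) = length x\<close> \<rho> by (simp add: Ss'_def)
    show "x ! i \<in> Span K (map ((!) x) Ss' @ Ws)" if "i < length x" for i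
      using span[OF that] mono_Span_sublist[OF K _ carr', of "map ((!) x) Ss @ Ws"] sub by auto
  qed
qed

text \<open>Independent coordinates of \<open>y\<close> lie in a space spanned by
  \<open>length Ss\<close> elements, so there are at most that many of them.\<close>

lemma rk_le:
  assumes "ring L" "subfield K L" "finite K" "set y \<subseteq> carrier L" "set Ss \<subseteq> {..<length y}"
    and span: "\<And>i. i < length y \<Longrightarrow> y ! i \<in> ring.Span L K (map ((!) y) Ss)"
  shows "rk L K y \<le> length Ss"
proof -
  interpret ring L by fact
  let ?A = "{card S |S. S \<subseteq> {..<length y} \<and> independent K (nths y S)}"
  have carr: "set (map ((!) y) Ss) \<subseteq> carrier L" using assms(4,5) by (auto simp: subset_iff)
  \<comment> \<open>The empty selection makes the set under \<open>Max\<close> nonempty.\<close>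
  have "independent K (nths y {})" by simp
  then have "card ({} :: nat set) \<in> ?A" by blast
  moreover have "finite ?A" by (rule finite_subset[of _ "card ` Pow {..<length y}"]) auto
  moreover have "c \<le> length Ss" if "c \<in> ?A" for c
  proof -
    obtain S where S: "c = card S" "S \<subseteq> {..<length y}" "independent K (nths y S)" using \<open>c \<in> ?A\<close> by blast
    have "set (nths y S) \<subseteq> Span K (map ((!) y) Ss)"
      using span by (auto simp: set_nths)
    then have "length (nths y S) \<le> length (map ((!) y) Ss)"
      using independent_length_le_spanning[OF assms(2,3) S(3) carr] by simp
    moreover have "{i. i < length y \<and> i \<in> S} = S" using S(2) by auto
    ultimately show ?thesis by (simp add: length_nths S(1))
  qed
  ultimately show ?thesis unfolding rk_def by (auto intro!: Max.boundedI)
qed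

section \<open>Linearized polynomials\<close>

text \<open>The linearized polynomials of q-degree below \<open>k\<close>, whose values at
  independent points form Gabidulin codewords. Coefficients are a function of the index, so that
  induction on \<open>k\<close> simply drops the last one.\<close>

definition (in ring) lin_poly :: "nat \<Rightarrow> nat \<Rightarrow> (nat \<Rightarrow> 'a) \<Rightarrow> 'a \<Rightarrow> 'a" where
  "lin_poly q k a x = (\<Oplus>j \<in> {..<k}. a j \<otimes> x [^] (q ^ j))"

lemma (in ring) lin_poly_0: "lin_poly q 0 a x = \<zero>"
  by (simp add: lin_poly_def)

lemma (in ring) lin_poly_Suc:
  assumes "a \<in> {..<Suc k} \<rightarrow> carrier R" "x \<in> carrier R"
  shows "lin_poly q (Suc k) a x = a k \<otimes> x [^] (q ^ k) \<oplus> lin_poly q k a x"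
  unfolding lin_poly_def lessThan_Suc using assms by (subst finsum_insert) (auto simp: Pi_def)

lemma (in ring) lin_poly_closed:
  assumes "a \<in> {..<k} \<rightarrow> carrier R" "x \<in> carrier R"
  shows "lin_poly q k a x \<in> carrier R"
  unfolding lin_poly_def using assms by (auto intro!: finsum_closed simp: Pi_def)

lemma (in ring) lin_poly_in_subring:
  assumes S: "subring S R" and a: "a \<in> {..<k} \<rightarrow> S" and x: "x \<in> S"
  shows "lin_poly q k a x \<in> S"
  using a
proof (induction k)
  case 0
  then show ?case using subringE(2)[OF S] by (simp add: lin_poly_0)
next
  case (Suc k)
  have "a \<in> {..<Suc k} \<rightarrow> carrier R" "x \<in> carrier R"
    using Suc.prems x subringE(1)[OF S] by auto
  moreover have "x [^] n \<in> S" for n :: nat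
    using x subringE(3,6)[OF S] by (induction n) auto
  moreover have "lin_poly q k a x \<in> S" using Suc by (simp add: Pi_def)
  ultimately show ?case
    using Suc.prems subringE(6,7)[OF S] by (simp add: lin_poly_Suc Pi_def)
qed

lemma (in cring) lin_poly_diff:
  assumes "a \<in> {..<k} \<rightarrow> carrier R" "b \<in> {..<k} \<rightarrow> carrier R" "x \<in> carrier R"
  shows "lin_poly q k (\<lambda>j. a j \<ominus> b j) x = lin_poly q k a x \<ominus> lin_poly q k b x"
  using assms(1,2)
proof (induction k)
  case 0
  then show ?case by (simp add: lin_poly_0 a_minus_def)
next
  case (Suc k)
  have carr: "a k \<in> carrier R" "b k \<in> carrier R" "x [^] (q ^ k) \<in> carrier R"
    "lin_poly q k a x \<in> carrier R" "lin_poly q k b x \<in> carrier R"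
    using Suc.prems assms(3) by (auto intro!: lin_poly_closed)
  have "lin_poly q (Suc k) (\<lambda>j. a j \<ominus> b j) x =
      (a k \<ominus> b k) \<otimes> x [^] (q ^ k) \<oplus> (lin_poly q k a x \<ominus> lin_poly q k b x)"
    using Suc.IH Suc.prems assms(3) by (subst lin_poly_Suc) (auto simp: Pi_def)
  also have "\<dots> = (a k \<otimes> x [^] (q ^ k) \<oplus> lin_poly q k a x) \<ominus> (b k \<otimes> x [^] (q ^ k) \<oplus> lin_poly q k b x)"
    using carr by algebra
  finally show ?case using Suc.prems assms(3) by (simp add: lin_poly_Suc)
qed

text \<open>Every exponent \<open>q ^ j\<close> is a power of \<open>p\<close>, so each term is
  additive by the freshman's dream.\<close>

lemma (in cring) lin_poly_add:
  assumes p: "prime p" "[p] \<cdot> \<one> = \<zero>" and q: "q = p ^ e"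
    and a: "a \<in> {..<k} \<rightarrow> carrier R" and x: "x \<in> carrier R" and y: "y \<in> carrier R"
  shows "lin_poly q k a (x \<oplus> y) = lin_poly q k a x \<oplus> lin_poly q k a y"
  using a
proof (induction k)
  case 0
  then show ?case by (simp add: lin_poly_0)
next
  case (Suc k)
  have carr: "a k \<in> carrier R" "x [^] (q ^ k) \<in> carrier R" "y [^] (q ^ k) \<in> carrier R"
    "lin_poly q k a x \<in> carrier R" "lin_poly q k a y \<in> carrier R"
    using Suc.prems x y by (auto intro!: lin_poly_closed)
  have "(x \<oplus> y) [^] (q ^ k) = x [^] (q ^ k) \<oplus> y [^] (q ^ k)"
    using freshman_dream[OF p x y, of "e * k"] by (simp add: q power_mult)
  then have "lin_poly q (Suc k) a (x \<oplus> y) =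
      a k \<otimes> (x [^] (q ^ k) \<oplus> y [^] (q ^ k)) \<oplus> (lin_poly q k a x \<oplus> lin_poly q k a y)"
    using Suc x y by (subst lin_poly_Suc) (simp_all add: Pi_def)
  also have "\<dots> = (a k \<otimes> x [^] (q ^ k) \<oplus> lin_poly q k a x) \<oplus> (a k \<otimes> y [^] (q ^ k) \<oplus> lin_poly q k a y)"
    using carr by algebra
  finally show ?case using Suc.prems x y by (simp add: lin_poly_Suc)
qed

text \<open>A scalar fixed by the \<open>q\<close>-th power is fixed by all its iterates. This
  applies to the elements of a subfield of order \<open>q\<close>.\<close>

lemma (in cring) lin_poly_smult:
  assumes c: "c \<in> carrier R" "c [^] q = c"
    and a: "a \<in> {..<k} \<rightarrow> carrier R" and x: "x \<in> carrier R"
  shows "lin_poly q k a (c \<otimes> x) = c \<otimes> lin_poly q k a x"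
  using a
proof (induction k)
  case 0
  then show ?case using c by (simp add: lin_poly_0)
next
  case (Suc k)
  have carr: "a k \<in> carrier R" "x [^] (q ^ k) \<in> carrier R" "lin_poly q k a x \<in> carrier R"
    using Suc.prems x by (auto intro!: lin_poly_closed)
  have "c [^] (q ^ k) = c"
    using c by (induction k) (simp_all flip: nat_pow_pow)
  then have "lin_poly q (Suc k) a (c \<otimes> x) = a k \<otimes> (c \<otimes> x [^] (q ^ k)) \<oplus> (c \<otimes> lin_poly q k a x)"
    using Suc c x by (subst lin_poly_Suc) (simp_all add: Pi_def nat_pow_distrib m_assoc)
  also have "\<dots> = c \<otimes> (a k \<otimes> x [^] (q ^ k) \<oplus> lin_poly q k a x)"
    using carr c by algebra
  finally show ?case using Suc.prems x by (simp add: lin_poly_Suc)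
qed

text \<open>This makes roots countable. The bound \<open>q * degree P \<le> q ^ k\<close> stands for
  degree at most q^(k-1) and also covers \<open>k = 0\<close>; the last conjunct ensures that a
  nonzero coefficient gives a nonzero polynomial.\<close>

lemma (in field) lin_poly_as_polynomial:
  assumes q: "2 \<le> q" and a: "a \<in> {..<k} \<rightarrow> carrier R"
  shows "\<exists>P \<in> carrier (poly_ring R). (\<forall>x \<in> carrier R. eval P x = lin_poly q k a x)
    \<and> q * degree P \<le> q ^ k \<and> (P = [] \<longrightarrow> (\<forall>j<k. a j = \<zero>))"
  using a
proof (induction k)
  case 0
  have "[] \<in> carrier (poly_ring R)" by (simp add: univ_poly_def polynomial_def)
  then show ?case by (intro bexI[of _ "[]"]) (auto simp: lin_poly_0)
next
  case (Suc k)
  then obtain P where P: "P \<in> carrier (poly_ring R)" "\<forall>x \<in> carrier R. eval P x = lin_poly q k a x"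
    "q * degree P \<le> q ^ k" "P = [] \<longrightarrow> (\<forall>j<k. a j = \<zero>)"
    by (auto simp: Pi_def)
  have ak: "a k \<in> carrier R" using Suc.prems by auto
  have Suc_eq: "lin_poly q (Suc k) a x = a k \<otimes> x [^] (q ^ k) \<oplus> lin_poly q k a x" if "x \<in> carrier R" for x
    using Suc.prems that by (rule lin_poly_Suc)
  show ?case
  proof (cases "a k = \<zero>")
    case True
    have "q * degree P \<le> q ^ Suc k"
      using P(3) q by (metis le_trans power_increasing[of k "Suc k" q] le_SucI order_refl one_le_numeral)
    moreover have "lin_poly q (Suc k) a x = lin_poly q k a x" if "x \<in> carrier R" for x
      using Suc_eq[OF that] True that lin_poly_closed[of a k x] Suc.prems by (simp add: Pi_def)
    ultimately show ?thesis using P True by (intro bexI[of _ P]) (auto simp: less_Suc_eq)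
  next
    case False
    let ?M = "monom (a k) (q ^ k)"
    have M: "polynomial (carrier R) ?M" using ak False carrier_is_subring by auto
    have deg_M: "degree ?M = q ^ k" by (simp add: monom_def)
    \<comment> \<open>The new leading monomial therefore cannot cancel against
      \<open>P\<close>.\<close>
    have deg_P: "degree P < q ^ k"
    proof (cases "degree P = 0")
      case False
      then have "degree P < q * degree P" using q by simp
      then show ?thesis using P(3) by (rule less_le_trans)
    qed (use q in simp)
    have P': "polynomial (carrier R) P" using P(1) by (simp add: univ_poly_carrier)
    have sets: "set ?M \<subseteq> carrier R" "set P \<subseteq> carrier R"
      using polynomial_in_carrier[OF carrier_is_subring] M P' by auto
    have "poly_add ?M P \<in> carrier (poly_ring R)"
      using poly_add_closed[OF carrier_is_subring M P'] by (simp add: univ_poly_carrier)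
    moreover have deg: "degree (poly_add ?M P) = q ^ k"
      using poly_add_degree_eq[OF carrier_is_subring M P'] deg_M deg_P by simp
    moreover have "eval (poly_add ?M P) x = lin_poly q (Suc k) a x" if "x \<in> carrier R" for x
      using eval_poly_add[OF sets that] eval_monom[OF ak that] P(2) that Suc_eq by simp
    moreover have "poly_add ?M P \<noteq> []" using deg q by (metis list.size(3) diff_0_eq_0 power_not_zero not_numeral_le_zero)
    ultimately show ?thesis by (intro bexI[of _ "poly_add ?M P"]) auto
  qed
qed

text \<open>With a nonzero coefficient there would be at least \<open>q ^ k\<close> roots, but the
  degree is at most q^(k-1).\<close>

lemma (in field) lin_poly_eq_zero:
  assumes q: "2 \<le> q" and a: "a \<in> {..<k} \<rightarrow> carrier R"
    and Z: "Z \<subseteq> carrier R" "q ^ k \<le> card Z" "\<And>x. x \<in> Z \<Longrightarrow> lin_poly q k a x = \<zero>"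
    and j: "j < k"
  shows "a j = \<zero>"
proof (rule ccontr)
  assume nz: "a j \<noteq> \<zero>"
  obtain P where P: "P \<in> carrier (poly_ring R)" "\<forall>x \<in> carrier R. eval P x = lin_poly q k a x"
    "q * degree P \<le> q ^ k" "P = [] \<longrightarrow> (\<forall>j<k. a j = \<zero>)"
    using lin_poly_as_polynomial[OF q a] by blast
  have "P \<noteq> []" using P(4) nz j by blast
  note roots = card_roots_le_degree[OF P(1) this]
  have "card Z \<le> card {x \<in> carrier R. eval P x = \<zero>}"
    by (rule card_mono[OF roots(1)]) (use Z P(2) in auto)
  then have "q ^ k \<le> degree P" using Z(2) roots(2) by linarith
  then have "q * q ^ k \<le> q ^ k" using P(3) by (meson le_trans mult_le_mono2)
  moreover have "q ^ k > 0" using q by simp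
  ultimately show False using q by simp
qed

text \<open>Evaluation at \<open>Bs\<close> maps coefficient tuples over the finite set
  \<open>S\<close> to value tuples over \<open>S\<close>. Both spaces are the same finite set, so
  surjectivity follows from injectivity.\<close>

lemma (in field) lin_poly_interpolation:
  assumes p: "prime p" "[p] \<cdot> \<one> = \<zero>" and K: "subfield K R" "finite K" and q: "card K = p ^ e"
    and S: "subring S R" "finite S" "K \<subseteq> S"
    and Bs: "independent K Bs" "set Bs \<subseteq> S" and t: "\<And>i. i < length Bs \<Longrightarrow> t i \<in> S"
  obtains a where "a \<in> {..<length Bs} \<rightarrow>\<^sub>E S"
    "\<And>i. i < length Bs \<Longrightarrow> lin_poly (card K) (length Bs) a (Bs ! i) = t i"
proof -
  let ?k = "length Bs" and ?q = "card K"
  define ev where "ev a = restrict (\<lambda>i. lin_poly ?q ?k a (Bs ! i)) {..<?k}" for a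
  have SR: "S \<subseteq> carrier R" using subringE(1)[OF S(1)] .
  have "finite ({..<?k} \<rightarrow>\<^sub>E S)" using S(2) by (intro finite_PiE) auto
  moreover have "ev ` ({..<?k} \<rightarrow>\<^sub>E S) \<subseteq> {..<?k} \<rightarrow>\<^sub>E S"
  proof (clarify)
    fix a assume "a \<in> {..<?k} \<rightarrow>\<^sub>E S"
    then have "a \<in> {..<?k} \<rightarrow> S" by auto
    then show "ev a \<in> {..<?k} \<rightarrow>\<^sub>E S"
      unfolding ev_def using Bs(2) by (auto intro!: lin_poly_in_subring[OF S(1)])
  qed
  moreover have "inj_on ev ({..<?k} \<rightarrow>\<^sub>E S)"
  proof (rule inj_onI)
    fix a b assume a: "a \<in> {..<?k} \<rightarrow>\<^sub>E S" and b: "b \<in> {..<?k} \<rightarrow>\<^sub>E S" and eq: "ev a = ev b"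
    let ?d = "\<lambda>j. a j \<ominus> b j"
    have a': "a \<in> {..<?k} \<rightarrow> carrier R" and b': "b \<in> {..<?k} \<rightarrow> carrier R"
      using a b SR by auto
    then have d: "?d \<in> {..<?k} \<rightarrow> carrier R" by auto
    have "lin_poly ?q ?k ?d x = \<zero>" if "x \<in> set Bs" for x
    proof -
      obtain i where i: "i < ?k" "x = Bs ! i" using \<open>x \<in> set Bs\<close> by (auto simp: in_set_conv_nth)
      have x: "x \<in> carrier R" using that Bs(2) SR by auto
      have "lin_poly ?q ?k a x = lin_poly ?q ?k b x"
        using fun_cong[OF eq, of i] i by (simp add: ev_def)
      then show ?thesis
        using lin_poly_diff[OF a' b' x] lin_poly_closed[OF b' x] by (simp add: a_minus_def r_neg)
    qed
    \<comment> \<open>The zeros of the difference form a \<open>K\<close>-subspace. It contains the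
      independent points \<open>Bs\<close>, hence their whole span, which has enough elements to
      force all coefficients to vanish.\<close>
    moreover have "subalgebra K {x \<in> carrier R. lin_poly ?q ?k ?d x = \<zero>} R"
    proof (intro subalgebra.intro add.subgroupI subalgebra_axioms.intro)
      have zero: "lin_poly ?q ?k ?d \<zero> = \<zero>"
        using lin_poly_smult[of \<zero> ?q ?d ?k \<zero>] d subfield_card_gt_1[OF K]
          lin_poly_closed[OF d zero_closed] by (simp add: nat_pow_zero)
      then show "{x \<in> carrier R. lin_poly ?q ?k ?d x = \<zero>} \<noteq> {}" by auto
      fix x assume x: "x \<in> {x \<in> carrier R. lin_poly ?q ?k ?d x = \<zero>}"
      have "lin_poly ?q ?k ?d (x \<oplus> \<ominus> x) = lin_poly ?q ?k ?d x \<oplus> lin_poly ?q ?k ?d (\<ominus> x)"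
        using lin_poly_add[OF p q d] x by simp
      then show "\<ominus> x \<in> {x \<in> carrier R. lin_poly ?q ?k ?d x = \<zero>}"
        using x zero lin_poly_closed[OF d, of "\<ominus> x"] by (auto simp: r_neg)
      show "x \<oplus> y \<in> {x \<in> carrier R. lin_poly ?q ?k ?d x = \<zero>}"
        if "y \<in> {x \<in> carrier R. lin_poly ?q ?k ?d x = \<zero>}" for y
        using lin_poly_add[OF p q d] x that by auto
      show "c \<otimes> x \<in> {x \<in> carrier R. lin_poly ?q ?k ?d x = \<zero>}" if "c \<in> K" for c
        using lin_poly_smult[OF _ subfield_pow_card[OF K that] d] x that subfieldE(3)[OF K(1)] by auto
    qed auto
    moreover have "set Bs \<subseteq> {x \<in> carrier R. lin_poly ?q ?k ?d x = \<zero>}"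
      using calculation(1) Bs(2) SR by auto
    ultimately have vanish: "Span K Bs \<subseteq> {x \<in> carrier R. lin_poly ?q ?k ?d x = \<zero>}"
      by (intro subalgebra_Span_incl[OF K(1)])
    have "?d j = \<zero>" if "j < ?k" for j
      by (rule lin_poly_eq_zero[OF _ d, where Z = "Span K Bs" and q = ?q])
         (use vanish card_Span_independent[OF K Bs(1)] subfield_card_gt_1[OF K] that in auto)
    then have "a j = b j" if "j < ?k" for j
      using that a' b' by (metis lessThan_iff r_right_minus_eq Pi_mem)
    then show "a = b" by (intro PiE_ext[OF a b]) auto
  qed
  ultimately have "ev ` ({..<?k} \<rightarrow>\<^sub>E S) = {..<?k} \<rightarrow>\<^sub>E S"
    by (rule endo_inj_surj)
  moreover have "restrict t {..<?k} \<in> {..<?k} \<rightarrow>\<^sub>E S" using t by auto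
  ultimately have "restrict t {..<?k} \<in> ev ` ({..<?k} \<rightarrow>\<^sub>E S)" by simp
  then obtain a where a: "a \<in> {..<?k} \<rightarrow>\<^sub>E S" "ev a = restrict t {..<?k}"
    by (elim imageE) simp
  show thesis
  proof (rule that[OF a(1)])
    fix i assume "i < ?k"
    then show "lin_poly ?q ?k a (Bs ! i) = t i" using fun_cong[OF a(2), of i] by (simp add: ev_def)
  qed
qed

section \<open>Semilinear maps\<close>

text \<open>Linearity over \<open>K\<close> for maps that run against the direction of
  \<open>h\<close>: the two rings may have different element types, so \<open>K\<close> acts on the
  domain through \<open>h\<close>.\<close>

definition (in ring_hom_ring) semilinear_on :: "'a set \<Rightarrow> 'c set \<Rightarrow> ('c \<Rightarrow> 'a) \<Rightarrow> bool" where
  "semilinear_on K V F \<longleftrightarrow> F \<in> V \<rightarrow> carrier R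
    \<and> (\<forall>x\<in>V. \<forall>y\<in>V. F (x \<oplus>\<^bsub>S\<^esub> y) = F x \<oplus> F y)
    \<and> (\<forall>c\<in>K. \<forall>x\<in>V. F (h c \<otimes>\<^bsub>S\<^esub> x) = c \<otimes> F x)"

lemma (in ring_hom_ring) semilinear_combine:
  assumes V: "subalgebra (h ` K) V S" and F: "semilinear_on K V F"
  shows "set Ks \<subseteq> K \<Longrightarrow> set Us \<subseteq> V \<Longrightarrow> length Ks = length Us \<Longrightarrow>
    S.combine (map h Ks) Us \<in> V \<and> F (S.combine (map h Ks) Us) = R.combine Ks (map F Us)"
proof (induction Ks arbitrary: Us)
  case Nil
  have zero: "\<zero>\<^bsub>S\<^esub> \<in> V"
    using subgroup.one_closed[OF subalgebra.axioms(1)[OF V]] by simp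
  then have "F \<zero>\<^bsub>S\<^esub> \<in> carrier R" "F \<zero>\<^bsub>S\<^esub> \<oplus> F \<zero>\<^bsub>S\<^esub> = F \<zero>\<^bsub>S\<^esub>"
    using F S.l_zero[OF S.zero_closed] unfolding semilinear_on_def by (auto, metis)
  then have "F \<zero>\<^bsub>S\<^esub> = \<zero>" by (metis R.add.l_cancel_one)
  then show ?case using zero by simp
next
  case (Cons k Ks)
  then obtain u Us' where Us: "Us = u # Us'" by (metis length_Suc_conv)
  have "h k \<otimes>\<^bsub>S\<^esub> u \<in> V"
    using subalgebra.smult_closed[OF V] Cons.prems Us by auto
  moreover have IH: "S.combine (map h Ks) Us' \<in> V"
    "F (S.combine (map h Ks) Us') = R.combine Ks (map F Us')"
    using Cons Us by auto
  moreover have "F (h k \<otimes>\<^bsub>S\<^esub> u) = k \<otimes> F u"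
    using F Cons.prems Us unfolding semilinear_on_def by auto
  ultimately show ?case
    using F subgroup.m_closed[OF subalgebra.axioms(1)[OF V]] unfolding semilinear_on_def Us by auto
qed

text \<open>The map reads off the coordinates with respect to \<open>gs\<close>, pulls them back
  along \<open>h\<close>, and uses them as coefficients on \<open>Ws\<close>. The list
  \<open>Ws\<close> may be dependent, which allows a domain larger than the image.\<close>

lemma (in ring_hom_ring) exists_semilinear:
  assumes K: "subfield K R" and K': "subfield (h ` K) S" and inj: "inj_on h K"
    and gs: "S.independent (h ` K) gs" and Ws: "set Ws \<subseteq> carrier R" "length Ws = length gs"
  obtains \<psi> where "semilinear_on K (S.Span (h ` K) gs) \<psi>" "R.Span K Ws \<subseteq> \<psi> ` S.Span (h ` K) gs"
proof -
  let ?V = "S.Span (h ` K) gs"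
  note gs_carr = S.independent_in_carrier[OF gs]
  have KR: "K \<subseteq> carrier R" using subfieldE(3)[OF K] .
  have ex1: "\<exists>!Ks. set Ks \<subseteq> K \<and> length Ks = length gs \<and> x = S.combine (map h Ks) gs" if "x \<in> ?V" for x
  proof -
    obtain Ks where Ks: "set Ks \<subseteq> h ` K" "length Ks = length gs" "x = S.combine Ks gs"
      and uniq: "\<And>Ks'. set Ks' \<subseteq> h ` K \<Longrightarrow> length Ks' = length gs \<Longrightarrow> x = S.combine Ks' gs \<Longrightarrow> Ks' = Ks"
      using S.unique_decomposition[OF K' gs \<open>x \<in> ?V\<close>] by blast
    define Ls where "Ls = map (inv_into K h) Ks"
    have Ls: "set Ls \<subseteq> K" "Ks = map h Ls"
      using Ks(1) unfolding Ls_def by (auto simp: inv_into_into subset_iff f_inv_into_f intro!: map_idI[symmetric])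
    show ?thesis
    proof (rule ex1I[of _ Ls])
      show "set Ls \<subseteq> K \<and> length Ls = length gs \<and> x = S.combine (map h Ls) gs"
        using Ks Ls by auto
      fix Ls' assume "set Ls' \<subseteq> K \<and> length Ls' = length gs \<and> x = S.combine (map h Ls') gs"
      then have "map h Ls' = map h Ls" and "set Ls' \<subseteq> K"
        using uniq[of "map h Ls'"] Ls(2) by auto
      moreover have "inj_on h (set Ls' \<union> set Ls)"
        using inj calculation(2) Ls(1) by (auto intro: inj_on_subset)
      ultimately show "Ls' = Ls" by (simp add: inj_on_map_eq_map)
    qed
  qed
  define coords where "coords x = (THE Ks. set Ks \<subseteq> K \<and> length Ks = length gs \<and> x = S.combine (map h Ks) gs)" for x
  have coords: "set (coords x) \<subseteq> K" "length (coords x) = length gs" "x = S.combine (map h (coords x)) gs"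
    if "x \<in> ?V" for x
    using theI'[OF ex1[OF that]] unfolding coords_def by auto
  have combine_V: "S.combine (map h Ks) gs \<in> ?V" if "set Ks \<subseteq> K" "length Ks = length gs" for Ks
    using S.Span_mem_iff_length_version[OF K' gs_carr] that by (metis length_map list.set_map image_mono)
  have coords_eq: "coords (S.combine (map h Ks) gs) = Ks" if "set Ks \<subseteq> K" "length Ks = length gs" for Ks
    using ex1[OF combine_V[OF that]] coords[OF combine_V[OF that]] that by metis
  define \<psi> where "\<psi> x = R.combine (coords x) Ws" for x
  have h_carr: "set (map h Ks) \<subseteq> carrier S" if "set Ks \<subseteq> K" for Ks
    using that KR by auto
  have sum_carr: "set (map2 (\<oplus>) Ks Ls) \<subseteq> K" if "set Ks \<subseteq> K" "set Ls \<subseteq> K" for Ks Ls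
    using that R.subring_props(7)[OF K] by clarsimp (blast dest: set_zip_leftD set_zip_rightD)
  have smult_carr: "set (map ((\<otimes>) c) Ks) \<subseteq> K" if "c \<in> K" "set Ks \<subseteq> K" for c Ks
    using that R.subring_props(6)[OF K] by auto
  have "semilinear_on K ?V \<psi>"
    unfolding semilinear_on_def
  proof (intro conjI ballI)
    show "\<psi> \<in> ?V \<rightarrow> carrier R"
      unfolding \<psi>_def using coords(1) KR Ws by (auto intro!: R.combine_in_carrier)
    show "\<psi> (x \<oplus>\<^bsub>S\<^esub> y) = \<psi> x \<oplus> \<psi> y" if "x \<in> ?V" "y \<in> ?V" for x y
    proof -
      let ?Ks = "coords x" and ?Ls = "coords y"
      note cx = coords[OF that(1)] and cy = coords[OF that(2)]
      have "map2 (\<oplus>\<^bsub>S\<^esub>) (map h ?Ks) (map h ?Ls) = map h (map2 (\<oplus>) ?Ks ?Ls)"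
        using cx(1,2) cy(1,2) KR by (auto intro!: nth_equalityI simp: subset_iff)
      then have "x \<oplus>\<^bsub>S\<^esub> y = S.combine (map h (map2 (\<oplus>) ?Ks ?Ls)) gs"
        using S.combine_add[of "map h ?Ks" gs "map h ?Ls"] cx cy h_carr gs_carr by simp
      then have "coords (x \<oplus>\<^bsub>S\<^esub> y) = map2 (\<oplus>) ?Ks ?Ls"
        using coords_eq[OF sum_carr[OF cx(1) cy(1)]] cx(2) cy(2) by simp
      then show ?thesis
        unfolding \<psi>_def using R.combine_add[of ?Ks Ws ?Ls] cx cy Ws KR by auto
    qed
    show "\<psi> (h c \<otimes>\<^bsub>S\<^esub> x) = c \<otimes> \<psi> x" if "c \<in> K" "x \<in> ?V" for c x
    proof -
      note cx = coords[OF that(2)]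
      have hc: "h c \<in> carrier S" using that(1) KR by auto
      have eq: "map ((\<otimes>\<^bsub>S\<^esub>) (h c)) (map h (coords x)) = map h (map ((\<otimes>) c) (coords x))"
        using cx(1) KR that(1) by (auto simp: subset_iff)
      have "h c \<otimes>\<^bsub>S\<^esub> x = S.combine (map h (map ((\<otimes>) c) (coords x))) gs"
        using S.combine_r_distr[OF h_carr[OF cx(1)] gs_carr hc] unfolding cx(3)[symmetric] eq .
      then have "coords (h c \<otimes>\<^bsub>S\<^esub> x) = map ((\<otimes>) c) (coords x)"
        using coords_eq[OF smult_carr[OF that(1) cx(1)]] cx(2) by simp
      moreover have "set (coords x) \<subseteq> carrier R" "c \<in> carrier R" using cx(1) KR that(1) by auto
      ultimately show ?thesis
        unfolding \<psi>_def by (simp add: R.combine_r_distr[OF _ Ws(1)])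
    qed
  qed
  moreover have "R.Span K Ws \<subseteq> \<psi> ` ?V"
  proof
    fix w assume "w \<in> R.Span K Ws"
    then obtain Ks where Ks: "set Ks \<subseteq> K" "length Ks = length gs" "w = R.combine Ks Ws"
      using R.Span_mem_iff_length_version[OF K Ws(1)] Ws(2) by auto
    then show "w \<in> \<psi> ` ?V"
      using combine_V coords_eq by (intro image_eqI[of _ _ "S.combine (map h Ks) gs"]) (auto simp: \<psi>_def)
  qed
  ultimately show thesis by (rule that)
qed

lemma (in ring) combine_minus_right:
  assumes "set Ks \<subseteq> carrier R" "\<And>j. j \<in> set js \<Longrightarrow> f j \<in> carrier R" "\<And>j. j \<in> set js \<Longrightarrow> g j \<in> carrier R"
  shows "combine Ks (map (\<lambda>j. f j \<ominus> g j) js) = combine Ks (map f js) \<ominus> combine Ks (map g js)"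
  using assms
proof (induction js arbitrary: Ks)
  case Nil
  then show ?case by (cases Ks) (auto simp: a_minus_def)
next
  case (Cons j js)
  show ?case
  proof (cases Ks)
    case Nil
    then show ?thesis by (simp add: a_minus_def)
  next
    case (Cons c Cs)
    have carr: "c \<in> carrier R" "f j \<in> carrier R" "g j \<in> carrier R"
      "combine Cs (map f js) \<in> carrier R" "combine Cs (map g js) \<in> carrier R"
      using Cons Cons.prems by (auto intro!: combine_in_carrier)
    have "combine Cs (map (\<lambda>j. f j \<ominus> g j) js) = combine Cs (map f js) \<ominus> combine Cs (map g js)"
      using Cons Cons.prems by (intro Cons.IH) auto
    then have "combine Ks (map (\<lambda>j. f j \<ominus> g j) (j # js))
        = c \<otimes> (f j \<ominus> g j) \<oplus> (combine Cs (map f js) \<ominus> combine Cs (map g js))"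
      using Cons by simp
    also have "\<dots> = (c \<otimes> f j \<oplus> combine Cs (map f js)) \<ominus> (c \<otimes> g j \<oplus> combine Cs (map g js))"
      using carr by (simp add: a_minus_def r_distr r_minus minus_add a_ac)
    finally show ?thesis using Cons by simp
  qed
qed

text \<open>Linearity turns the condition on \<open>F\<close> into F(g_i) = t + sum c_j F(g_j).
  Subtracting this from the equation for \<open>x i\<close> cancels \<open>t\<close>, so the
  differences satisfy the same relation without a residue.\<close>

lemma (in ring_hom_ring) semilinear_correction:
  assumes K: "K \<subseteq> carrier R" and V: "subalgebra (h ` K) V S" and F: "semilinear_on K V F"
    and Ks: "set Ks \<subseteq> K" "length Ks = length js"
    and g: "g i \<in> V" "\<And>j. j \<in> set js \<Longrightarrow> g j \<in> V"
    and x: "\<And>j. j \<in> set js \<Longrightarrow> x j \<in> carrier R" and t: "t \<in> carrier R"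
    and xi: "x i = R.combine Ks (map x js) \<oplus> t"
    and Ft: "F (g i \<ominus>\<^bsub>S\<^esub> S.combine (map h Ks) (map g js)) = t"
  shows "x i \<ominus> F (g i) = R.combine Ks (map (\<lambda>j. x j \<ominus> F (g j)) js)"
proof -
  let ?b = "g i \<ominus>\<^bsub>S\<^esub> S.combine (map h Ks) (map g js)"
  have VS: "V \<subseteq> carrier S" using S.subalgebra_in_carrier[OF V] .
  have comb: "S.combine (map h Ks) (map g js) \<in> V"
    "F (S.combine (map h Ks) (map g js)) = R.combine Ks (map (\<lambda>j. F (g j)) js)"
    using semilinear_combine[OF V F Ks(1), of "map g js"] Ks(2) g(2) by (auto simp: comp_def)
  have b: "?b \<in> V"
    using subgroup.m_closed[OF subalgebra.axioms(1)[OF V] g(1)]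
      subgroup.m_inv_closed[OF subalgebra.axioms(1)[OF V] comb(1)]
    by (simp add: a_minus_def a_inv_def)
  have "?b \<oplus>\<^bsub>S\<^esub> S.combine (map h Ks) (map g js) = g i"
    using comb(1) g(1) VS by (simp add: a_minus_def S.a_assoc S.l_neg subset_iff)
  then have Fgi: "F (g i) = t \<oplus> R.combine Ks (map (\<lambda>j. F (g j)) js)"
    using F b comb Ft unfolding semilinear_on_def by metis
  have Fg: "F (g j) \<in> carrier R" if "j \<in> set js" for j
    using F g(2)[OF that] unfolding semilinear_on_def by auto
  have KsR: "set Ks \<subseteq> carrier R" using Ks K by auto
  have carr: "R.combine Ks (map x js) \<in> carrier R" "R.combine Ks (map (\<lambda>j. F (g j)) js) \<in> carrier R"
    using KsR x Fg by (auto intro!: R.combine_in_carrier)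
  have "x i \<ominus> F (g i) = R.combine Ks (map x js) \<ominus> R.combine Ks (map (\<lambda>j. F (g j)) js)"
    unfolding xi Fgi using carr t R.a_assoc[of "R.combine Ks (map x js)" t "\<ominus> t"]
    by (simp add: a_minus_def R.minus_add R.a_assoc[symmetric] R.r_neg)
  also have "\<dots> = R.combine Ks (map (\<lambda>j. x j \<ominus> F (g j)) js)"
    by (rule R.combine_minus_right[symmetric]) (use KsR x Fg in auto)
  finally show ?thesis .
qed

text \<open>Over a finite carrier every \<open>Max\<close> and \<open>Min\<close> in the definitions
  ranges over a finite set, so pointwise covering suffices.\<close>

lemma K_R_le:
  assumes fin: "finite (carrier L)" and C: "C \<subseteq> vectors L n" "C \<noteq> {}"
    and cover: "\<And>x. x \<in> vectors L n \<Longrightarrow> \<exists>c\<in>C. rank_dist L K x c \<le> \<rho>"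
  shows "K_R L K n \<rho> \<le> card C"
proof -
  have finV: "finite (vectors L n)"
    unfolding vectors_def using finite_lists_length_eq[OF fin] by (simp add: conj_commute)
  then have finC: "finite C" using C(1) finite_subset by blast
  have "covering_radius L K n C \<le> \<rho>"
    unfolding covering_radius_def
  proof (rule Max.boundedI)
    show "finite ((\<lambda>x. Min (rank_dist L K x ` C)) ` vectors L n)" using finV by simp
    show "(\<lambda>x. Min (rank_dist L K x ` C)) ` vectors L n \<noteq> {}" using C by auto
    fix r assume "r \<in> (\<lambda>x. Min (rank_dist L K x ` C)) ` vectors L n"
    then obtain x where "x \<in> vectors L n" "r = Min (rank_dist L K x ` C)" by blast
    then show "r \<le> \<rho>" using cover finC by (metis Min_le finite_imageI image_eqI le_trans)
  qed
  then have "card C \<in> {card C |C. C \<subseteq> vectors L n \<and> C \<noteq> {} \<and> covering_radius L K n C \<le> \<rho>}"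
    using C by blast
  moreover have "finite {card C |C. C \<subseteq> vectors L n \<and> C \<noteq> {} \<and> covering_radius L K n C \<le> \<rho>}"
    by (rule finite_subset[of _ "card ` Pow (vectors L n)"]) (use finV in auto)
  ultimately show ?thesis unfolding K_R_def by (rule Min_le[rotated])
qed

section \<open>The covering code\<close>

lemma (in field) frobenius_fixed_subfield:
  fixes p e N :: nat
  assumes p: "prime p" and char: "[p] \<cdot> \<one> = \<zero>" and K: "subfield K R" "card K = p ^ e" "finite K"
  defines "S \<equiv> {x \<in> carrier R. x [^] (card K ^ N) = x}"
  shows "subring S R" "K \<subseteq> S" "subalgebra K S R"
proof -
  have Q: "card K ^ N = p ^ (e * N)" by (simp add: K(2) power_mult)
  have Q0: "card K ^ N > 0" using subfield_card_gt_1[OF K(1,3)] by simp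
  have add: "x \<oplus> y \<in> S" if "x \<in> S" "y \<in> S" for x y
    using that freshman_dream[OF p char, of x y "e * N"] unfolding S_def Q by auto
  have mult: "x \<otimes> y \<in> S" if "x \<in> S" "y \<in> S" for x y
    using that unfolding S_def by (auto simp: nat_pow_distrib)
  have zero: "\<zero> \<in> S" using Q0 unfolding S_def by (simp add: nat_pow_zero)
  \<comment> \<open>Additivity at x + (-x) settles negation without a case distinction on the parity
    of the exponent.\<close>
  have neg: "\<ominus> x \<in> S" if "x \<in> S" for x
  proof -
    have x: "x \<in> carrier R" "x [^] (card K ^ N) = x" using that by (auto simp: S_def)
    have "\<zero> = (x \<oplus> \<ominus> x) [^] (card K ^ N)"
      using x Q0 by (simp add: r_neg nat_pow_zero)
    also have "\<dots> = x \<oplus> (\<ominus> x) [^] (card K ^ N)"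
      using freshman_dream[OF p char x(1), of "\<ominus> x" "e * N"] x Q by simp
    finally have "(\<ominus> x) [^] (card K ^ N) = \<ominus> x"
      using x by (metis a_inv_closed minus_equality nat_pow_closed a_comm)
    then show ?thesis using x by (simp add: S_def)
  qed
  show "subring S R"
  proof (rule subringI)
    show "S \<subseteq> carrier R" by (auto simp: S_def)
    show "\<one> \<in> S" by (simp add: S_def)
  qed (use add mult neg in auto)
  show KS: "K \<subseteq> S"
  proof
    fix c assume c: "c \<in> K"
    have "c \<in> carrier R" using c subfieldE(3)[OF K(1)] by auto
    moreover have "c [^] (card K ^ N) = c"
      using subfield_pow_card[OF K(1,3) c] calculation by (induction N) (simp_all flip: nat_pow_pow)
    ultimately show "c \<in> S" by (simp add: S_def)
  qed
  show "subalgebra K S R"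
  proof (intro subalgebra.intro subalgebra_axioms.intro add.subgroupI)
    show "S \<noteq> {}" using zero by blast
  qed (use add mult neg KS in \<open>auto simp: S_def\<close>)
qed

lemma (in field) exists_algebraically_closed_extension:
  obtains E :: "(('a list \<times> nat) multiset \<Rightarrow> 'a) ring" and h
  where "field E" "ring_hom_ring R E h" "inj h" "\<And>P. P \<in> carrier (poly_ring E) \<Longrightarrow> ring.splitted E P"
proof -
  interpret E: algebraic_closure alg_closure "indexed_const ` carrier R"
    by (rule alg_closureE)
  show thesis
  proof (rule that)
    show "field alg_closure" by unfold_locales
    show "ring_hom_ring R alg_closure indexed_const"
      using ring_hom_ringI2[OF ring_axioms E.ring_axioms alg_closureE(2)] .
    show "inj indexed_const" by (rule indexed_const_is_inj)
  qed (rule E.roots_over_carrier)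
qed

lemma (in ring_hom_ring) semilinear_comp:
  assumes "semilinear_on K V F" "G \<in> V \<rightarrow> V"
    and "\<And>x y. x \<in> V \<Longrightarrow> y \<in> V \<Longrightarrow> G (x \<oplus>\<^bsub>S\<^esub> y) = G x \<oplus>\<^bsub>S\<^esub> G y"
    and "\<And>c x. c \<in> K \<Longrightarrow> x \<in> V \<Longrightarrow> G (h c \<otimes>\<^bsub>S\<^esub> x) = h c \<otimes>\<^bsub>S\<^esub> G x"
  shows "semilinear_on K V (\<lambda>x. F (G x))"
  using assms unfolding semilinear_on_def Pi_def by simp

theorem corollary6:
  fixes L :: "('a, 'b) ring_scheme" and K :: "'a set" and q m n \<rho> :: nat
  assumes "primepow q"
    and "field L" and "subfield K L"
    and "card K = q" and "card (carrier L) = q ^ m"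
    and "0 < \<rho>" and "\<rho> < n" and "n \<le> m"
  shows "K_R L K n \<rho> \<le> q ^ (max (m - \<rho>) n * (n - \<rho>))"
proof -
  interpret L: field L by fact
  note K = \<open>subfield K L\<close> and q = \<open>card K = q\<close>
  \<comment> \<open>\<open>N \<ge> n\<close> provides \<open>n\<close> independent evaluation points
    in \<open>S\<close>, and \<open>N \<ge> m - \<rho>\<close> lets \<open>S\<close> map onto
    \<open>W\<close>. The number \<open>k\<close> counts both the coefficients and the positions
    outside \<open>J\<close>.\<close>
  define N where "N = max (m - \<rho>) n"
  define k where "k = n - \<rho>"
  obtain p e where p: "prime p" "0 < e" "q = p ^ e"
    using \<open>primepow q\<close> by (auto simp: primepow_def)
  have q_pos: "q > 0" using p by (simp add: prime_gt_0_nat)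
  have finL: "finite (carrier L)" using assms(5) q_pos by (metis card_gt_0_iff zero_less_power)
  have KL: "K \<subseteq> carrier L" using subfieldE(3)[OF K] .
  have finK: "finite K" using KL finL finite_subset by blast
  have q_gt_1: "1 < q" using L.subfield_card_gt_1[OF K finK] q by simp

  \<comment> \<open>The subspace \<open>W\<close> of \<open>L\<close>, spanned by
    \<open>Ws\<close>\<close>
  obtain Vs where Vs: "L.independent K Vs" "L.Span K Vs = carrier L"
    using L.finite_subalgebra_base[OF K L.carrier_is_subalgebra[OF KL] finL] .
  have "q ^ length Vs = q ^ m"
    using L.card_Span_independent[OF K finK Vs(1)] Vs(2) q assms(5) by simp
  then have len_Vs: "length Vs = m" using q_gt_1 by simp
  have dim: "L.dimension m K (carrier L)"
    using L.dimensionI[OF K Vs] len_Vs by simp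
  define Ws where "Ws = take (m - \<rho>) Vs"
  have Ws: "L.independent K Ws" "length Ws = m - \<rho>"
    unfolding Ws_def using L.independent_split(2)[OF K, of "take (m - \<rho>) Vs" "drop (m - \<rho>) Vs"] Vs len_Vs
    by simp_all
  note Ws_carr = L.independent_in_carrier[OF Ws(1)]

  \<comment> \<open>The field \<open>S\<close> with \<open>q ^ N\<close> elements\<close>
  obtain \<Omega> :: "(('a list \<times> nat) multiset \<Rightarrow> 'a) ring" and h
    where \<Omega>: "field \<Omega>" "ring_hom_ring L \<Omega> h" "inj h"
      and splits: "\<And>P. P \<in> carrier (poly_ring \<Omega>) \<Longrightarrow> ring.splitted \<Omega> P"
    using L.exists_algebraically_closed_extension by metis
  interpret \<Omega>: field \<Omega> by fact
  interpret h: ring_hom_ring L \<Omega> h by fact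
  define K' where "K' = h ` K"
  have K': "subfield K' \<Omega>"
    unfolding K'_def by (rule h.img_is_subfield(2)[OF K \<Omega>.one_not_zero])
  have card_K': "card K' = q"
    unfolding K'_def using card_image[OF inj_on_subset[OF \<Omega>(3)], of K] q by simp
  have finK': "finite K'" unfolding K'_def using finK by simp
  \<comment> \<open>In general \<open>S\<close> neither contains the image of \<open>L\<close> nor
    lies in it, since \<open>N\<close> need not divide \<open>m\<close>; the copy \<open>K'\<close>
    of \<open>K\<close> is common to both.\<close>
  define S where "S = {x \<in> carrier \<Omega>. x [^]\<^bsub>\<Omega>\<^esub> (q ^ N) = x}"
  have char: "[p] \<cdot>\<^bsub>\<Omega>\<^esub> \<one>\<^bsub>\<Omega>\<^esub> = \<zero>\<^bsub>\<Omega>\<^esub>"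
    using \<Omega>.char_prime[of p e] \<Omega>.card_subfield_add_pow[OF K' finK'] card_K' p(3) by simp
  have card_K'_pow: "card K' = p ^ e" using card_K' p(3) by simp
  note fixed = \<Omega>.frobenius_fixed_subfield[OF p(1) char K' card_K'_pow finK', of N, unfolded card_K', folded S_def]
  have "0 < e * N" using p(2) assms(6,7) by (simp add: N_def)
  then have card_S: "card S = q ^ N"
    using \<Omega>.card_frobenius_fixed[OF splits p(1) char, of "e * N"] unfolding S_def p(3)
    by (simp add: power_mult)
  then have finS: "finite S" using q_pos by (metis card_gt_0_iff zero_less_power)
  obtain gs where gs: "\<Omega>.independent K' gs" "\<Omega>.Span K' gs = S"
    using \<Omega>.finite_subalgebra_base[OF K' fixed(3) finS] .
  have "q ^ length gs = q ^ N"
    using \<Omega>.card_Span_independent[OF K' finK' gs(1)] gs(2) card_S card_K' by simp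
  then have len_gs: "length gs = N" using q_gt_1 by simp
  have gs_S: "gs ! i \<in> S" if "i < n" for i
    using \<Omega>.Span_base_incl[OF K' \<Omega>.independent_in_carrier[OF gs(1)]] gs(2) that len_gs
    by (auto simp: N_def subset_iff)

  \<comment> \<open>Zeros pad \<open>Ws\<close> to the length of \<open>gs\<close>: the surplus base
    elements of \<open>S\<close> are sent to zero.\<close>
  define Ws' where "Ws' = Ws @ replicate (N - (m - \<rho>)) \<zero>\<^bsub>L\<^esub>"
  have Ws': "set Ws' \<subseteq> carrier L" "length Ws' = length gs"
    unfolding Ws'_def using Ws_carr Ws(2) len_gs by (auto simp: N_def)
  obtain \<psi> where \<psi>: "h.semilinear_on K S \<psi>" "L.Span K Ws' \<subseteq> \<psi> ` S"
    using h.exists_semilinear[OF K K'[unfolded K'_def] inj_on_subset[OF \<Omega>(3) subset_UNIV] gs(1)[unfolded K'_def] Ws']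
    unfolding K'_def[symmetric] gs(2) by blast
  have Ws_img: "L.Span K Ws \<subseteq> \<psi> ` S"
    using L.mono_Span_sublist[OF K _ Ws'(1), of Ws] \<psi>(2) by (auto simp: Ws'_def)

  define F where "F a x = \<psi> (\<Omega>.lin_poly q k a x)" for a x
  have F: "h.semilinear_on K S (F a)" if a: "a \<in> {..<k} \<rightarrow>\<^sub>E S" for a
  proof -
    have SO: "S \<subseteq> carrier \<Omega>" by (auto simp: S_def)
    have aS: "a \<in> {..<k} \<rightarrow> S" and aO: "a \<in> {..<k} \<rightarrow> carrier \<Omega>" using a SO by auto
    show ?thesis
      unfolding F_def
    proof (rule h.semilinear_comp[OF \<psi>(1)])
      show "\<Omega>.lin_poly q k a \<in> S \<rightarrow> S"
        using \<Omega>.lin_poly_in_subring[OF fixed(1) aS] by auto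
      show "\<Omega>.lin_poly q k a (x \<oplus>\<^bsub>\<Omega>\<^esub> y) = \<Omega>.lin_poly q k a x \<oplus>\<^bsub>\<Omega>\<^esub> \<Omega>.lin_poly q k a y"
        if "x \<in> S" "y \<in> S" for x y
        using \<Omega>.lin_poly_add[OF p(1) char p(3) aO] that SO by auto
      show "\<Omega>.lin_poly q k a (h c \<otimes>\<^bsub>\<Omega>\<^esub> x) = h c \<otimes>\<^bsub>\<Omega>\<^esub> \<Omega>.lin_poly q k a x"
        if "c \<in> K" "x \<in> S" for c x
      proof (rule \<Omega>.lin_poly_smult[OF _ _ aO])
        have "h c \<in> K'" using that by (simp add: K'_def)
        then show "h c [^]\<^bsub>\<Omega>\<^esub> q = h c"
          using \<Omega>.subfield_pow_card[OF K' finK'] card_K' by simp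
      qed (use that KL SO in auto)
    qed
  qed
  \<comment> \<open>Different coefficients may give the same word, as \<open>\<psi>\<close> can have
    a kernel. The number of coefficient tuples is thus used only as an upper bound for
    \<open>card C\<close>.\<close>
  define C where "C = (\<lambda>a. map (\<lambda>i. F a (gs ! i)) [0..<n]) ` ({..<k} \<rightarrow>\<^sub>E S)"
  have F_carr: "F a x \<in> carrier L" if "a \<in> {..<k} \<rightarrow>\<^sub>E S" "x \<in> S" for a x
    using F[OF that(1)] that(2) by (auto simp: h.semilinear_on_def)
  have "S \<noteq> {}" using subringE(2)[OF fixed(1)] by auto
  then have "C \<noteq> {}" by (simp add: C_def PiE_eq_empty_iff)
  moreover have "C \<subseteq> vectors L n"
    using F_carr gs_S by (auto simp: C_def vectors_def)
  moreover have "\<exists>c\<in>C. rank_dist L K x c \<le> \<rho>" if "x \<in> vectors L n" for x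
  proof -

    \<comment> \<open>Covering a given vector \<open>x\<close>\<close>
    have len_x: "length x = n" and x: "set x \<subseteq> carrier L" using that by (auto simp: vectors_def)
    obtain Ss Ts where ST: "distinct (Ss @ Ts)" "set (Ss @ Ts) = {..<n}" "length Ss = \<rho>"
      and span: "\<And>i. i < n \<Longrightarrow> x ! i \<in> L.Span K (map ((!) x) Ss @ Ws)"
      using L.exists_spanning_coordinates[OF K dim Ws, of x] x len_x assms(6-8) by auto
    have len_Ts: "length Ts = k"
      using distinct_card[OF ST(1)] ST(2,3) by (simp add: k_def)
    have x_nth: "x ! i \<in> carrier L" if "i < n" for i
      using x len_x that nth_mem by blast
    have Ss_n: "j < n" if "j \<in> set Ss" for j using ST(2) that by auto
    have Ts_n: "j < n" if "j \<in> set Ts" for j using ST(2) that by auto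
    have xSs: "set (map ((!) x) Ss) \<subseteq> carrier L" using x_nth Ss_n by auto
    \<comment> \<open>The residue of \<open>x ! i\<close> in \<open>W\<close> is lifted through
      \<open>\<psi>\<close> to an element of \<open>S\<close>, because interpolation prescribes
      values in \<open>S\<close>.\<close>
    have "\<exists>Ks s. set Ks \<subseteq> K \<and> length Ks = length Ss \<and> s \<in> S \<and>
        x ! i = L.combine Ks (map ((!) x) Ss) \<oplus>\<^bsub>L\<^esub> \<psi> s" if i: "i < n" for i
    proof -
      obtain u w where u: "u \<in> L.Span K (map ((!) x) Ss)" "w \<in> L.Span K Ws" "x ! i = u \<oplus>\<^bsub>L\<^esub> w"
        using span[OF i] unfolding L.Span_append_eq_set_add[OF K xSs Ws_carr] set_add_def' by blast
      then show ?thesis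
        using Ws_img L.Span_mem_iff_length_version[OF K xSs, of u] by (auto simp: subset_iff image_iff)
    qed
    then obtain Cs s where Cs: "\<And>i. i < n \<Longrightarrow> set (Cs i) \<subseteq> K" "\<And>i. i < n \<Longrightarrow> length (Cs i) = length Ss"
      and s: "\<And>i. i < n \<Longrightarrow> s i \<in> S"
      and x_eq: "\<And>i. i < n \<Longrightarrow> x ! i = L.combine (Cs i) (map ((!) x) Ss) \<oplus>\<^bsub>L\<^esub> \<psi> (s i)"
      by metis
    define comb where "comb i = \<Omega>.combine (map h (Cs i)) (map ((!) gs) Ss)" for i
    define Bs where "Bs = map2 (\<lambda>a b. a \<ominus>\<^bsub>\<Omega>\<^esub> b) (map ((!) gs) Ts) (map comb Ts)"
    \<comment> \<open>The first \<open>n\<close> evaluation points are reordered with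
      \<open>Ts\<close> in front, since \<open>independent_shift\<close> modifies a prefix by
      elements of the span of the rest.\<close>
    have "\<Omega>.independent K' (map ((!) gs) (Ts @ Ss))"
    proof (rule \<Omega>.independent_same_set[OF K'])
      show "\<Omega>.independent K' (take n gs)"
        using \<Omega>.independent_split(2)[OF K', of "take n gs" "drop n gs"] gs(1) by simp
      have "set (take n gs) = (!) gs ` {..<n}"
        using len_gs by (simp add: N_def nth_image[symmetric] lessThan_atLeast0)
      then show "set (take n gs) = set (map ((!) gs) (Ts @ Ss))" using ST(2) by auto
      show "length (take n gs) = length (map ((!) gs) (Ts @ Ss))"
        using len_gs len_Ts ST(3) assms(7) by (simp add: N_def k_def)
    qed
    then have indep: "\<Omega>.independent K' (map ((!) gs) Ts @ map ((!) gs) Ss)" by simp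
    have gSs: "set (map ((!) gs) Ss) \<subseteq> carrier \<Omega>"
      using \<Omega>.independent_in_carrier[OF indep] by simp
    have comb: "comb i \<in> \<Omega>.Span K' (map ((!) gs) Ss)" if "i < n" for i
      unfolding comb_def using \<Omega>.Span_mem_iff_length_version[OF K' gSs] Cs[OF that]
      by (metis K'_def image_mono length_map list.set_map)
    have Bs_indep: "\<Omega>.independent K' Bs"
    proof -
      have "\<Omega>.independent K' (Bs @ map ((!) gs) Ss)"
        unfolding Bs_def by (rule \<Omega>.independent_shift[OF K' indep]) (use comb Ts_n in auto)
      then show ?thesis by (rule \<Omega>.independent_split(2)[OF K'])
    qed
    have len_Bs: "length Bs = k" by (simp add: Bs_def len_Ts)
    have "set (map ((!) gs) Ss) \<subseteq> S" using gs_S Ss_n by auto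
    then have "\<Omega>.Span K' (map ((!) gs) Ss) \<subseteq> S" by (rule \<Omega>.subalgebra_Span_incl[OF K' fixed(3)])
    then have comb_S: "comb i \<in> S" if "i < n" for i using comb[OF that] by blast
    have Bs_nth: "Bs ! l = gs ! (Ts ! l) \<ominus>\<^bsub>\<Omega>\<^esub> comb (Ts ! l)" if "l < k" for l
      using that len_Ts by (simp add: Bs_def)
    have diff_S: "u \<ominus>\<^bsub>\<Omega>\<^esub> v \<in> S" if "u \<in> S" "v \<in> S" for u v
      using that subringE(5,7)[OF fixed(1)] by (simp add: a_minus_def)
    have Ts_nth: "Ts ! l < n" if "l < k" for l using Ts_n that len_Ts by simp
    have Bs_S: "set Bs \<subseteq> S"
      using Bs_nth len_Bs Ts_nth gs_S comb_S diff_S by (auto simp: in_set_conv_nth)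
    have sTs: "s (Ts ! l) \<in> S" if "l < length Bs" for l
      using s Ts_nth that len_Bs by simp
    obtain a where a: "a \<in> {..<k} \<rightarrow>\<^sub>E S"
      and interp: "\<And>l. l < k \<Longrightarrow> \<Omega>.lin_poly q k a (Bs ! l) = s (Ts ! l)"
      using \<Omega>.lin_poly_interpolation[OF p(1) char K' finK' _ fixed(1) finS fixed(2) Bs_indep Bs_S,
          of e "\<lambda>l. s (Ts ! l)"] sTs
      unfolding len_Bs card_K' using p(3) by blast
    define c where "c = map (\<lambda>i. F a (gs ! i)) [0..<n]"
    have "c \<in> C" using a by (auto simp: C_def c_def)
    define y where "y = vec_diff L x c"
    have len_y: "length y = n" by (simp add: y_def vec_diff_def c_def len_x)
    have y_nth: "y ! i = x ! i \<ominus>\<^bsub>L\<^esub> F a (gs ! i)" if "i < n" for i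
      using that len_x by (simp add: y_def vec_diff_def c_def)
    have y_carr: "y ! i \<in> carrier L" if "i < n" for i
      using that y_nth x_nth F_carr[OF a gs_S] by simp
    have ySs: "set (map ((!) y) Ss) \<subseteq> carrier L" using y_carr Ss_n by auto
    \<comment> \<open>At positions in \<open>Ss\<close> this is immediate. At the others the
      interpolation condition removes the residue, and \<open>y\<close> inherits the linear relation
      with coefficients \<open>Cs i\<close>.\<close>
    have "y ! i \<in> L.Span K (map ((!) y) Ss)" if i: "i < n" for i
    proof (cases "i \<in> set Ss")
      case True
      then show ?thesis using L.Span_base_incl[OF K ySs] by auto
    next
      case False
      then obtain l where l: "l < k" "i = Ts ! l"
        using ST(2) i len_Ts by (metis UnE in_set_conv_nth lessThan_iff set_append)
      have "F a (gs ! i \<ominus>\<^bsub>\<Omega>\<^esub> comb i) = \<psi> (s i)"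
        using interp[OF l(1)] Bs_nth[OF l(1)] l(2) by (simp add: F_def)
      then have "x ! i \<ominus>\<^bsub>L\<^esub> F a (gs ! i) = L.combine (Cs i) (map (\<lambda>j. x ! j \<ominus>\<^bsub>L\<^esub> F a (gs ! j)) Ss)"
        using h.semilinear_correction[OF KL fixed(3)[unfolded K'_def] F[OF a] Cs[OF i], of "(!) gs" i "(!) x" "\<psi> (s i)"]
          gs_S i Ss_n x_nth x_eq[OF i] s[OF i] \<psi>(1)
        by (auto simp: comb_def h.semilinear_on_def)
      then have "y ! i = L.combine (Cs i) (map ((!) y) Ss)"
        using y_nth i Ss_n by (simp cong: map_cong)
      then show ?thesis
        using L.Span_mem_iff_length_version[OF K ySs] Cs[OF i] by auto
    qed
    moreover have "set y \<subseteq> carrier L" using y_carr len_y by (auto simp: in_set_conv_nth)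
    moreover have "set Ss \<subseteq> {..<length y}" using Ss_n len_y by auto
    ultimately have "rk L K y \<le> length Ss"
      by (intro rk_le[OF L.ring_axioms K finK]) (simp_all add: len_y)
    then show ?thesis using \<open>c \<in> C\<close> ST(3) by (auto simp: rank_dist_def y_def)
  qed
  ultimately have "K_R L K n \<rho> \<le> card C"
    by (intro K_R_le[OF finL])
  also have "\<dots> \<le> card ({..<k} \<rightarrow>\<^sub>E S)"
    unfolding C_def by (rule card_image_le) (use finS in \<open>auto intro: finite_PiE\<close>)
  also have "\<dots> = q ^ (N * k)"
    by (simp add: card_PiE card_S power_mult)
  finally show ?thesis by (simp add: N_def k_def)
qed

end
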